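(* Let $K=\mathbb{Q}(\sqrt[4]{2})$ and let $X_{m,1}$ ($m\ge 1$) be the Oeljeklaus--Toma threefold $X_{m,n}$ defined in the context with $n=1$. Then for every integer $m\ge 1$, $$H_1(X_{m,1},\mathbb{Z})\cong\begin{cases}(\mathbb{Z}/2\mathbb{Z})^2\oplus\mathbb{Z}^2 & \text{if } 6\nmid m,\\ (\mathbb{Z}/2\mathbb{Z})^2\oplus\mathbb{Z}/7\mathbb{Z}\oplus\mathbb{Z}^2 & \text{if } 6\mid m.\end{cases}$$
   Context: Let $w=\sqrt[4]{2}$ and $K=\mathbb{Q}(w)$, which has two real embeddings $\sigma_1,\sigma_2$ (with $\sigma_1(w)=\sqrt[4]{2}$, $\sigma_2(w)=-\sqrt[4]{2}$) and one pair of complex conjugate embeddings, of which one, $\sigma_3$, is chosen. Its ring of integers is $\mathcal{O}_K=\mathbb{Z}[w]$. Put $u=w^2-1$ and $v=w+1$, which are units of $\mathcal{O}_K$; the group of totally positive units (positive under $\sigma_1$ and $\sigma_2$) is $\mathcal{O}_K^{\times,+}=\langle u,v^2\rangle\cong\mathbb{Z}^2$. For integers $m,n\ge1$ let $U_{m,n}=\langle u^m,v^{2n}\rangle$, acting on the additive group $\mathcal{O}_K$ by multiplication, and form the semidirect product $\mathcal{O}_K\rtimes U_{m,n}$ with product $(h_1,k_1)(h_2,k_2)=(h_1+k_1h_2,\,k_1k_2)$. With $\mathbb{H}$ the upper half plane, this group acts properly discontinuously on $\mathbb{H}^2\times\mathbb{C}$ by $$(h,k)\cdot(z_1,z_2,z_3)=(\sigma_1(h)+\sigma_1(k)z_1,\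 \sigma_2(h)+\sigma_2(k)z_2,\ \sigma_3(h)+\sigma_3(k)z_3),$$ and $X_{m,n}=(\mathbb{H}^2\times\mathbb{C})/(\mathcal{O}_K\rtimes U_{m,n})$. Its fundamental group is $\mathcal{O}_K\rtimes U_{m,n}$. *)

theory Defs
  imports
    "HOL-Homology.Homology"
    "HOL-Algebra.Generated_Fields"
    "HOL-Algebra.Group_Action"
    "HOL-Computational_Algebra.Polynomial"
begin

definition type_field :: "'a::field ring" where
  "type_field = \<lparr>carrier = UNIV, monoid.mult = (*), one = 1, zero = 0, add = (+)\<rparr>"

definition w\<^sub>K :: real where "w\<^sub>K = root 4 2"

text \<open>The field is realised inside the reals through the embedding that sends the generator
  to the positive fourth root of 2.\<close>

definition K :: "real ring" where
  "K = type_field\<lparr>carrier := generate_field type_field {w\<^sub>K}\<rparr>"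

definition O\<^sub>K :: "real ring" where
  "O\<^sub>K = K\<lparr>carrier := {x \<in> carrier K. algebraic_int x}\<rparr>"

lemma field_type_field: "field (type_field :: 'a::field ring)"
proof (rule cring.cring_fieldI2)
  show "cring (type_field :: 'a ring)"
    by (rule cringI; unfold_locales?)
      (auto simp: type_field_def Units_def algebra_simps intro: exI[of _ "- _"])
qed (auto simp: type_field_def intro: right_inverse)

definition u\<^sub>K :: real where "u\<^sub>K = w\<^sub>K\<^sup>2 - 1"

definition v\<^sub>K :: real where "v\<^sub>K = w\<^sub>K + 1"

text \<open>The library's \<open>subgroup_generated\<close> silently discards generators outside the carrier,
  so it matters that \<open>u\<^sub>K\<close> and \<open>v\<^sub>K\<close> are units of \<open>O\<^sub>K\<close>.\<close>

lemma w\<^sub>K_power4: "w\<^sub>K ^ 4 = 2"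
  by (simp add: w\<^sub>K_def)

lemma carrier_K_intros:
  "w\<^sub>K \<in> carrier K" "1 \<in> carrier K"
  "x \<in> carrier K \<Longrightarrow> y \<in> carrier K \<Longrightarrow> x + y \<in> carrier K"
  "x \<in> carrier K \<Longrightarrow> y \<in> carrier K \<Longrightarrow> x * y \<in> carrier K"
  "x \<in> carrier K \<Longrightarrow> - x \<in> carrier K"
proof -
  let ?F = "type_field :: real ring"
  have carr: "carrier K = generate_field ?F {w\<^sub>K}" by (simp add: K_def)
  show "w\<^sub>K \<in> carrier K" by (simp add: carr generate_field.incl)
  show "1 \<in> carrier K" using generate_field.one[of ?F "{w\<^sub>K}"] by (simp add: carr type_field_def)
  show "x \<in> carrier K \<Longrightarrow> y \<in> carrier K \<Longrightarrow> x + y \<in> carrier K"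
    using generate_field.eng_add[of x ?F "{w\<^sub>K}" y] by (simp add: carr type_field_def)
  show "x \<in> carrier K \<Longrightarrow> y \<in> carrier K \<Longrightarrow> x * y \<in> carrier K"
    using generate_field.eng_mult[of x ?F "{w\<^sub>K}" y] by (simp add: carr type_field_def)
  interpret field ?F by (rule field_type_field)
  have "\<ominus>\<^bsub>?F\<^esub> x = - x"
    by (rule minus_equality) (auto simp: type_field_def)
  then show "x \<in> carrier K \<Longrightarrow> - x \<in> carrier K"
    using generate_field.a_inv[of x ?F "{w\<^sub>K}"] by (simp add: carr)
qed

lemma
  shows u\<^sub>K_unit: "u\<^sub>K \<in> Units O\<^sub>K" and v\<^sub>K_unit: "v\<^sub>K \<in> Units O\<^sub>K"
proof -
  have unitI: "x \<in> Units O\<^sub>K"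
    if "x \<in> carrier K" "y \<in> carrier K" "algebraic_int x" "algebraic_int y" "x * y = 1" for x y
    using that by (auto simp: Units_def O\<^sub>K_def K_def type_field_def mult.commute intro!: bexI[of _ y])
  have w4: "w\<^sub>K * (w\<^sub>K * (w\<^sub>K * w\<^sub>K)) = 2"
    using w\<^sub>K_power4 by (simp add: power4_eq_xxxx mult.assoc)
  have alg: "algebraic_int x" if "lead_coeff p = 1" "poly (map_poly of_int p) x = 0" for x :: real and p
    using that by (auto simp: algebraic_int_altdef_ipoly)
  have u: "u\<^sub>K = w\<^sub>K * w\<^sub>K + - 1" by (simp add: u\<^sub>K_def power2_eq_square)
  define u' where "u' = w\<^sub>K * w\<^sub>K + 1"
  define v' where "v' = w\<^sub>K * (w\<^sub>K * w\<^sub>K) + - (w\<^sub>K * w\<^sub>K) + (w\<^sub>K + - 1)"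
  have uu: "u\<^sub>K * u' = 1" unfolding u u'_def using w4 by (simp add: algebra_simps)
  have vv: "v\<^sub>K * v' = 1" unfolding v\<^sub>K_def v'_def using w4 by (simp add: algebra_simps)
  have au: "algebraic_int u\<^sub>K"
    by (rule alg[of "[:-1, 2, 1:]"]) (use w4 in \<open>simp_all add: u map_poly_pCons algebra_simps\<close>)
  have au': "algebraic_int u'"
    by (rule alg[of "[:-1, -2, 1:]"]) (use w4 in \<open>simp_all add: u'_def map_poly_pCons algebra_simps\<close>)
  have pv: "v\<^sub>K ^ 4 - 4 * v\<^sub>K ^ 3 + 6 * v\<^sub>K\<^sup>2 - 4 * v\<^sub>K - 1 = 0"
    unfolding v\<^sub>K_def using w4 by (simp add: algebra_simps eval_nat_numeral)
  have av: "algebraic_int v\<^sub>K"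
    by (rule alg[of "[:-1, -4, 6, -4, 1:]"])
      (use pv in \<open>simp_all add: map_poly_pCons algebra_simps eval_nat_numeral\<close>)
  have cancel: "v\<^sub>K * (v' * x) = x" for x
    using vv by (simp add: mult.assoc [symmetric])
  have "v' ^ 4 + 4 * v' ^ 3 - 6 * v'\<^sup>2 + 4 * v' - 1
      = - (v\<^sub>K ^ 4 - 4 * v\<^sub>K ^ 3 + 6 * v\<^sub>K\<^sup>2 - 4 * v\<^sub>K - 1) * v' ^ 4"
    by (simp add: algebra_simps eval_nat_numeral cancel vv)
  then have pv': "v' ^ 4 + 4 * v' ^ 3 - 6 * v'\<^sup>2 + 4 * v' - 1 = 0"
    using pv by simp
  have av': "algebraic_int v'"
    by (rule alg[of "[:-1, 4, -6, 4, 1:]"])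
      (use pv' in \<open>simp_all add: map_poly_pCons algebra_simps eval_nat_numeral\<close>)
  show "u\<^sub>K \<in> Units O\<^sub>K"
    by (rule unitI[OF _ _ au au' uu]) (unfold u u'_def, (intro carrier_K_intros)+)
  show "v\<^sub>K \<in> Units O\<^sub>K"
    by (rule unitI[OF _ _ av av' vv]) (unfold v\<^sub>K_def v'_def, (intro carrier_K_intros)+)
qed

definition U :: "nat \<Rightarrow> nat \<Rightarrow> real monoid" where
  "U m n = subgroup_generated (units_of O\<^sub>K) {u\<^sub>K ^ m, v\<^sub>K ^ (2 * n)}"

definition field_embeddings :: "(real \<Rightarrow> 'a::field) set" where
  "field_embeddings = ring_hom K type_field"

definition OT_group :: "nat \<Rightarrow> nat \<Rightarrow> (real \<times> real) monoid" where
  "OT_group m n =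
     \<lparr>carrier = carrier O\<^sub>K \<times> carrier (U m n),
      monoid.mult = (\<lambda>(h\<^sub>1, k\<^sub>1) (h\<^sub>2, k\<^sub>2). (h\<^sub>1 + k\<^sub>1 * h\<^sub>2, k\<^sub>1 * k\<^sub>2)),
      one = (0, 1)\<rparr>"

definition HHC :: "(complex \<times> complex \<times> complex) set" where
  "HHC = {(z\<^sub>1, z\<^sub>2, z\<^sub>3). Im z\<^sub>1 > 0 \<and> Im z\<^sub>2 > 0}"

definition OT_action ::
    "(real \<Rightarrow> real) \<Rightarrow> (real \<Rightarrow> real) \<Rightarrow> (real \<Rightarrow> complex) \<Rightarrow> real \<times> real
      \<Rightarrow> complex \<times> complex \<times> complex \<Rightarrow> complex \<times> complex \<times> complex" where
  "OT_action \<sigma>\<^sub>1 \<sigma>\<^sub>2 \<sigma>\<^sub>3 = (\<lambda>(h, k) (z\<^sub>1, z\<^sub>2, z\<^sub>3).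
     (of_real (\<sigma>\<^sub>1 h) + of_real (\<sigma>\<^sub>1 k) * z\<^sub>1,
      of_real (\<sigma>\<^sub>2 h) + of_real (\<sigma>\<^sub>2 k) * z\<^sub>2,
      \<sigma>\<^sub>3 h + \<sigma>\<^sub>3 k * z\<^sub>3))"

definition quotient_topology :: "'a topology \<Rightarrow> ('a \<Rightarrow> 'b) \<Rightarrow> 'b topology" where
  "quotient_topology X f =
     topology (\<lambda>V. V \<subseteq> f ` topspace X \<and> openin X {x \<in> topspace X. f x \<in> V})"

lemma openin_quotient_topology:
  "openin (quotient_topology X f) V \<longleftrightarrow>
     V \<subseteq> f ` topspace X \<and> openin X {x \<in> topspace X. f x \<in> V}"
proof -
  let ?P = "\<lambda>V. V \<subseteq> f ` topspace X \<and> openin X {x \<in> topspace X. f x \<in> V}"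
  have "istopology ?P"
    unfolding istopology_def
  proof (intro conjI allI impI)
    fix S T assume "?P S" "?P T"
    moreover have "{x \<in> topspace X. f x \<in> S \<inter> T}
        = {x \<in> topspace X. f x \<in> S} \<inter> {x \<in> topspace X. f x \<in> T}" by auto
    ultimately show "S \<inter> T \<subseteq> f ` topspace X" "openin X {x \<in> topspace X. f x \<in> S \<inter> T}"
      by (auto intro: openin_Int)
  next
    fix \<K> assume "\<forall>S\<in>\<K>. ?P S"
    moreover have "{x \<in> topspace X. f x \<in> \<Union>\<K>} = (\<Union>S\<in>\<K>. {x \<in> topspace X. f x \<in> S})" by auto
    ultimately show "\<Union>\<K> \<subseteq> f ` topspace X" "openin X {x \<in> topspace X. f x \<in> \<Union>\<K>}"
      by (auto intro!: openin_Union)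
  qed
  then show ?thesis
    by (simp add: quotient_topology_def)
qed

lemma topspace_quotient_topology [simp]: "topspace (quotient_topology X f) = f ` topspace X"
proof -
  have "{x \<in> topspace X. f x \<in> f ` topspace X} = topspace X" by auto
  then have "openin (quotient_topology X f) (f ` topspace X)"
    by (simp add: openin_quotient_topology)
  then show ?thesis
    by (meson openin_quotient_topology openin_subset openin_topspace subset_antisym)
qed

lemma quotient_map_quotient_topology: "quotient_map X (quotient_topology X f) f"
  by (auto simp: quotient_map_def openin_quotient_topology)

definition OT_space ::
    "(real \<Rightarrow> real) \<Rightarrow> (real \<Rightarrow> real) \<Rightarrow> (real \<Rightarrow> complex) \<Rightarrow> nat \<Rightarrow> nat
      \<Rightarrow> (complex \<times> complex \<times> complex) set topology" where
  "OT_space \<sigma>\<^sub>1 \<sigma>\<^sub>2 \<sigma>\<^sub>3 m n =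
     quotient_topology (top_of_set HHC) (orbit (OT_group m n) (OT_action \<sigma>\<^sub>1 \<sigma>\<^sub>2 \<sigma>\<^sub>3))"

end

theory Submission
  imports Defs "HOL-Computational_Algebra.Primes"
begin

text \<open>
  A group \<open>G\<close> acting freely, properly discontinuously and affinely on a convex set \<open>X\<close> satisfies
  \<open>H\<^sub>1(X/G) \<cong> G\<^sup>a\<^sup>b\<close>. The map \<open>G \<rightarrow> H\<^sub>1(X/G)\<close> sends \<open>g\<close> to the image of the segment from a base point
  \<open>x\<^sub>0\<close> to \<open>g x\<^sub>0\<close>. It is a homomorphism because triangles in \<open>X\<close> bound, and onto because a
  lifted 1-simplex from \<open>x\<close> to \<open>y\<close> is homologous in \<open>X\<close> to a segment between translates of \<open>x\<^sub>0\<close>, up to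
  correction terms that depend only on the orbits of \<open>x\<close> and \<open>y\<close> and cancel on cycles. A homomorphism
  from \<open>G\<close> to an abelian group kills every \<open>g\<close> whose loop bounds, since the deck elements along the
  faces of a 2-simplex multiply to the identity.

  For the arithmetic, \<open>O\<^sub>K = Z[w]\<close>, because \<open>Z[w]/p\<close> is reduced for odd \<open>p\<close> and \<open>w\<close> generates a prime
  ideal above 2. The commutators of \<open>O\<^sub>K \<rtimes> U\<close> generate the ideal \<open>(v\<^sup>2 - 1, u\<^sup>m - 1)\<close>. Here
  \<open>v\<^sup>2 - 1 = w\<^sup>2 (1 + w\<^sup>3)\<close>, where \<open>1 + w\<^sup>3\<close> generates the kernel of \<open>Z[w] \<rightarrow> Z/7\<close>, \<open>w \<mapsto> -2\<close>, and \<open>w\<^sup>2\<close>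
  divides \<open>u\<^sup>m - 1\<close>. As \<open>u\<close> maps to 3, which has order 6 modulo 7, the ideal is \<open>(w\<^sup>2 (1 + w\<^sup>3))\<close>
  if 6 divides \<open>m\<close> and \<open>(w\<^sup>2)\<close> otherwise.
\<close>

section \<open>Lifting through a free properly discontinuous action\<close>

text \<open>\<open>wandering\<close> packs freeness and proper discontinuity, in the sense of
  covering theory, into one condition: small neighbourhoods are disjoint from their other
  translates. \<open>act_affine\<close> makes translates of segments segments, so that segments with
  translated end points have the same image in the orbit space.\<close>

locale free_affine_action = group G for G (structure) +
  fixes act :: "'a \<Rightarrow> 'x::euclidean_space \<Rightarrow> 'x" and X :: "'x set"
  assumes convex_X: "convex X" and nonempty_X: "X \<noteq> {}"
    and act_closed: "\<lbrakk>g \<in> carrier G; x \<in> X\<rbrakk> \<Longrightarrow> act g x \<in> X"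
    and act_one: "x \<in> X \<Longrightarrow> act \<one> x = x"
    and act_mult: "\<lbrakk>g \<in> carrier G; h \<in> carrier G; x \<in> X\<rbrakk> \<Longrightarrow> act (g \<otimes> h) x = act g (act h x)"
    and act_cont: "g \<in> carrier G \<Longrightarrow> continuous_on X (act g)"
    and act_affine: "\<lbrakk>g \<in> carrier G; x \<in> X; y \<in> X; 0 \<le> s; 0 \<le> t; s + t = 1\<rbrakk>
      \<Longrightarrow> act g (s *\<^sub>R x + t *\<^sub>R y) = s *\<^sub>R act g x + t *\<^sub>R act g y"
    and wandering: "x \<in> X \<Longrightarrow> \<exists>W. openin (top_of_set X) W \<and> x \<in> W \<and>
      (\<forall>g\<in>carrier G. \<forall>y\<in>W. act g y \<in> W \<longrightarrow> g = \<one>)"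
begin

abbreviation "pr \<equiv> orbit G act"
abbreviation "Y \<equiv> quotient_topology (top_of_set X) pr"

section \<open>Orbits and openness of the orbit map\<close>

lemma act_inv: "\<lbrakk>g \<in> carrier G; x \<in> X\<rbrakk> \<Longrightarrow> act (inv g) (act g x) = x"
  and act_inv': "\<lbrakk>g \<in> carrier G; x \<in> X\<rbrakk> \<Longrightarrow> act g (act (inv g) x) = x"
  by (metis act_mult act_one inv_closed l_inv, metis act_mult act_one inv_closed r_inv)

lemma act_free:
  assumes "g \<in> carrier G" "x \<in> X" "act g x = x" shows "g = \<one>"
  using wandering[OF assms(2)] assms by metis

lemma act_cancel:
  assumes "g \<in> carrier G" "h \<in> carrier G" "x \<in> X" "act g x = act h x" shows "g = h"
proof -
  have "act (inv h \<otimes> g) x = x"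
    using assms act_mult act_inv by simp
  then have "inv h \<otimes> g = \<one>"
    using act_free assms by auto
  then show ?thesis
    using assms by (metis inv_closed inv_equality inv_inv)
qed

lemma pr_self: "x \<in> X \<Longrightarrow> x \<in> pr x"
  unfolding orbit_def using act_one by force

lemma pr_act: 
  assumes "g \<in> carrier G" "x \<in> X" shows "pr (act g x) = pr x"
proof -
  show ?thesis
  proof (intro equalityI subsetI)
    fix y assume "y \<in> pr (act g x)"
    then obtain h where h: "h \<in> carrier G" "y = act h (act g x)" unfolding orbit_def by auto
    then have "h \<otimes> g \<in> carrier G" "y = act (h \<otimes> g) x" using assms act_mult by auto
    then show "y \<in> pr x" unfolding orbit_def by blast
  next
    fix y assume "y \<in> pr x"
    then obtain h where h: "h \<in> carrier G" "y = act h x" unfolding orbit_def by auto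
    then have "h \<otimes> inv g \<in> carrier G" "y = act (h \<otimes> inv g) (act g x)"
      using assms act_mult act_inv act_closed by auto
    then show "y \<in> pr (act g x)" unfolding orbit_def by blast
  qed
qed

lemma pr_eq_iff:
  assumes "x \<in> X" "y \<in> X" shows "pr x = pr y \<longleftrightarrow> (\<exists>g\<in>carrier G. y = act g x)"
proof
  assume "pr x = pr y"
  then show "\<exists>g\<in>carrier G. y = act g x"
    using pr_self[OF assms(2)] unfolding orbit_def by auto
qed (use assms pr_act in auto)

lemma continuous_map_pr: "continuous_map (top_of_set X) Y pr"
  using quotient_map_quotient_topology quotient_imp_continuous_map by blast

lemma openin_act:
  assumes "g \<in> carrier G" "openin (top_of_set X) W" shows "openin (top_of_set X) (act g ` W)"
proof -
  have WX: "W \<subseteq> X" using assms openin_imp_subset by blast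
  have "act g ` W = X \<inter> act (inv g) -` W"
    using WX assms(1) act_inv act_inv' act_closed
    by (auto simp: subset_iff image_iff) (metis inv_closed)
  moreover have "openin (top_of_set X) (X \<inter> act (inv g) -` W)"
    by (rule continuous_openin_preimage[OF act_cont _ assms(2)]) (use assms act_closed in auto)
  ultimately show ?thesis by simp
qed

text \<open>The preimage of the image of \<open>W\<close> is the union of the translates of
  \<open>W\<close>, and each group element acts by a homeomorphism.\<close>

lemma openin_pr:
  assumes "openin (top_of_set X) W" shows "openin Y (pr ` W)"
proof -
  have WX: "W \<subseteq> X" using assms openin_imp_subset by blast
  have "{x \<in> X. pr x \<in> pr ` W} = (\<Union>g\<in>carrier G. act g ` W)"
  proof (intro equalityI subsetI)
    fix x assume "x \<in> {x \<in> X. pr x \<in> pr ` W}"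
    then obtain y where "x \<in> X" "y \<in> W" "pr x = pr y" by auto
    then show "x \<in> (\<Union>g\<in>carrier G. act g ` W)"
      using pr_eq_iff[of y x] WX by auto
  next
    fix x assume "x \<in> (\<Union>g\<in>carrier G. act g ` W)"
    then obtain g y where "g \<in> carrier G" "y \<in> W" "x = act g y" by auto
    then show "x \<in> {x \<in> X. pr x \<in> pr ` W}"
      using WX by (auto simp: pr_act act_closed subset_iff)
  qed
  moreover have "openin (top_of_set X) (\<Union>g\<in>carrier G. act g ` W)"
    using openin_act assms by blast
  ultimately show ?thesis
    using WX by (auto simp: openin_quotient_topology)
qed

lemma openin_preimage_pr:
  assumes "continuous_map (top_of_set S) Y f" "openin (top_of_set X) W"
  shows "openin (top_of_set S) {s \<in> S. f s \<in> pr ` W}"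
  using openin_continuous_map_preimage[OF assms(1) openin_pr[OF assms(2)]] by simp

section \<open>Coverings and lifts over convex sets\<close>

text \<open>The orbit space is not a subset of a normed space, as the lifting theorems of the library require.
  The covering pulled back along a map out of a convex set is.\<close>

definition pullback :: "'s::topological_space set \<Rightarrow> ('s \<Rightarrow> 'x set) \<Rightarrow> ('s \<times> 'x) set"
  where "pullback S f = {(s, x). s \<in> S \<and> x \<in> X \<and> pr x = f s}"

text \<open>Let \<open>W\<close> be a wandering neighbourhood of a point over \<open>f s0\<close>.
  Over the open set \<open>T\<close> where \<open>f\<close> lands in the image of \<open>W\<close>,
  the sheets are indexed by the group: sheet \<open>g\<close> holds the points whose second
  component lies in the translate of \<open>W\<close> by \<open>g\<close>.\<close>

lemma covering_space_pullback:
  assumes f: "continuous_map (top_of_set S) Y f"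
  shows "covering_space (pullback S f) fst S"
proof
  let ?E = "pullback S f"
  show "continuous_on ?E fst" by (rule continuous_on_fst[OF continuous_on_id])
  have ftop: "f s \<in> pr ` X" if "s \<in> S" for s
    using f that by (auto simp: continuous_map_def)
  show "fst ` ?E = S"
    using ftop by (fastforce simp: pullback_def image_iff)
  fix s0 assume "s0 \<in> S"
  then obtain x0 where x0: "x0 \<in> X" "f s0 = pr x0" using ftop by auto
  obtain W where W: "openin (top_of_set X) W" "x0 \<in> W"
    and W1: "\<And>g y. \<lbrakk>g \<in> carrier G; y \<in> W; act g y \<in> W\<rbrakk> \<Longrightarrow> g = \<one>"
    using wandering[OF x0(1)] by blast
  have WX: "W \<subseteq> X" using W openin_imp_subset by blast
  define T where "T = {s \<in> S. f s \<in> pr ` W}"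
  define v where "v = (\<lambda>g. {p \<in> ?E. snd p \<in> act g ` W}) ` carrier G"
  \<comment> \<open>Since \<open>W\<close> meets each orbit at most once, this representative in
    \<open>W\<close> is the only one; it provides the local section.\<close>
  define r where "r s = (SOME y. y \<in> W \<and> pr y = f s)" for s
  have r: "r s \<in> W" "pr (r s) = f s" if s: "s \<in> T" for s
  proof -
    obtain y where "y \<in> W \<and> pr y = f s" using s unfolding T_def by (metis (no_types, lifting) image_iff mem_Collect_eq)
    then have "r s \<in> W \<and> pr (r s) = f s" unfolding r_def by (rule someI)
    then show "r s \<in> W" "pr (r s) = f s" by blast+
  qed
  have r_eq: "y = r s" if "s \<in> T" "y \<in> W" "pr y = f s" for s y
  proof -
    have "\<exists>g\<in>carrier G. y = act g (r s)" using pr_eq_iff[of "r s" y] r[OF that(1)] that WX by auto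
    then show ?thesis using W1 r(1)[OF that(1)] that(2) act_one WX by blast
  qed
  \<comment> \<open>Continuity comes from the openness of \<open>pr\<close>: the preimage under
    \<open>r\<close> of an open part \<open>U\<close> of \<open>W\<close> is the set where
    \<open>f\<close> lands in the image of \<open>U\<close>.\<close>
  have contr: "continuous_on T r"
  proof -
    have "openin (top_of_set T) (T \<inter> r -` U)" if U: "openin (top_of_set W) U" for U
    proof -
      have UX: "openin (top_of_set X) U" using U W(1) openin_trans by blast
      have UW: "U \<subseteq> W" using U openin_imp_subset by blast
      have "T \<inter> r -` U = T \<inter> {s \<in> S. f s \<in> pr ` U}"
      proof (intro equalityI subsetI)
        fix s assume s: "s \<in> T \<inter> r -` U"
        then have "f s = pr (r s)" "r s \<in> U" "s \<in> S" using r(2)[of s] by (auto simp: T_def)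
        then show "s \<in> T \<inter> {s \<in> S. f s \<in> pr ` U}" using s by blast
      next
        fix s assume s: "s \<in> T \<inter> {s \<in> S. f s \<in> pr ` U}"
        then obtain y where "y \<in> U" "pr y = f s" by auto
        then show "s \<in> T \<inter> r -` U" using r_eq[of s y] UW s by auto
      qed
      also have "openin (top_of_set T) \<dots>"
      proof -
        obtain B where "open B" "{s \<in> S. f s \<in> pr ` U} = S \<inter> B"
          using openin_preimage_pr[OF f UX] unfolding openin_open by blast
        moreover have "T \<subseteq> S" by (auto simp: T_def)
        ultimately show ?thesis unfolding openin_open by (intro exI[of _ B]) blast
      qed
      finally show ?thesis .
    qed
    then show ?thesis
      using r(1) by (subst continuous_on_open_gen[of r T W]) auto
  qed
  show "\<exists>T. s0 \<in> T \<and> openin (top_of_set S) T \<and> (\<exists>v. \<Union>v = ?E \<inter> fst -` T \<and>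
      (\<forall>u\<in>v. openin (top_of_set ?E) u) \<and> pairwise disjnt v \<and> (\<forall>u\<in>v. \<exists>q. homeomorphism u T fst q))"
  proof (intro exI[of _ T] exI[of _ v] conjI ballI)
    show "s0 \<in> T" using \<open>s0 \<in> S\<close> x0 W(2) by (auto simp: T_def)
    show "openin (top_of_set S) T" unfolding T_def by (rule openin_preimage_pr[OF f W(1)])
    show "\<Union> v = ?E \<inter> fst -` T"
    proof (intro equalityI subsetI)
      fix p assume "p \<in> \<Union>v"
      then obtain g y where "g \<in> carrier G" "p \<in> ?E" "y \<in> W" "snd p = act g y" by (auto simp: v_def)
      then show "p \<in> ?E \<inter> fst -` T"
        using pr_act WX by (auto simp: T_def pullback_def subset_iff) (metis imageI)
    next
      fix p assume p: "p \<in> ?E \<inter> fst -` T"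
      then obtain y where "y \<in> W" "pr y = f (fst p)" by (auto simp: T_def)
      then have "\<exists>g\<in>carrier G. snd p = act g y"
        using pr_eq_iff[of y "snd p"] p WX by (auto simp: pullback_def)
      then show "p \<in> \<Union>v"
        using p \<open>y \<in> W\<close> by (auto simp: v_def)
    qed
    show "pairwise disjnt v"
    proof -
      \<comment> \<open>If the translates of \<open>W\<close> by \<open>g\<close> and
        \<open>h\<close> meet, then \<open>inv h \<otimes> g\<close> moves a point of
        \<open>W\<close> into \<open>W\<close>.\<close>
      have "g = h" if "g \<in> carrier G" "h \<in> carrier G" "y \<in> W" "z \<in> W" "act g y = act h z" for g h y z
      proof -
        have "act (inv h \<otimes> g) y = z"
          using that WX act_mult act_inv by (auto simp: subset_iff)
        then have "inv h \<otimes> g = \<one>" using W1 that by auto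
        then show ?thesis using that by (metis inv_closed inv_equality inv_inv)
      qed
      then show ?thesis
        unfolding v_def pairwise_def disjnt_def by (auto simp: image_iff) metis+
    qed
    fix u assume "u \<in> v"
    then obtain g where g: "g \<in> carrier G" and u: "u = {p \<in> ?E. snd p \<in> act g ` W}" by (auto simp: v_def)
    have "u = ?E \<inter> snd -` (act g ` W)" using u by auto
    moreover have "openin (top_of_set ?E) (?E \<inter> snd -` (act g ` W))"
      by (rule continuous_openin_preimage[OF _ _ openin_act[OF g W(1)]])
        (auto simp: pullback_def intro!: continuous_intros)
    ultimately show "openin (top_of_set ?E) u" by simp
    have "homeomorphism u T fst (\<lambda>s. (s, act g (r s)))"
    proof (rule homeomorphismI)
      show "continuous_on u fst" by (intro continuous_intros)
      have "continuous_on T (act g \<circ> r)"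
        by (rule continuous_on_compose[OF contr continuous_on_subset[OF act_cont[OF g]]]) (use r WX in auto)
      then show "continuous_on T (\<lambda>s. (s, act g (r s)))"
        by (intro continuous_intros) (simp add: o_def)
      have u_props: "fst p \<in> T \<and> (\<exists>y\<in>W. snd p = act g y \<and> pr y = f (fst p))" if p: "p \<in> u" for p
      proof -
        obtain y where y: "p \<in> ?E" "y \<in> W" "snd p = act g y" using p by (auto simp: u)
        then have "pr y = f (fst p)" "fst p \<in> S"
          using pr_act[OF g, of y] WX by (auto simp: pullback_def)
        then show ?thesis
          unfolding T_def using y by (metis (mono_tags, lifting) imageI mem_Collect_eq)
      qed
      then show "fst ` u \<subseteq> T" by blast
      show "(\<lambda>s. (s, act g (r s))) ` T \<subseteq> u"
      proof clarify
        fix s assume s: "s \<in> T"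
        then have "r s \<in> X" "s \<in> S" "r s \<in> W" using r(1) WX by (auto simp: T_def)
        moreover have "pr (act g (r s)) = f s"
          using pr_act[OF g \<open>r s \<in> X\<close>] r(2)[OF s] by metis
        ultimately show "(s, act g (r s)) \<in> u"
          unfolding u pullback_def using act_closed[OF g] by force
      qed
      fix p assume "p \<in> u"
      then show "(fst p, act g (r (fst p))) = p"
        using u_props r_eq by (metis prod.collapse)
    qed auto
    then show "\<exists>q. homeomorphism u T fst q" by blast
  qed
qed

text \<open>A convex set is simply connected and locally path connected, so its identity map lifts
  to the pulled back covering; the second component of this section lifts \<open>f\<close>.\<close>

lemma lift_exists:
  fixes S :: "'s::euclidean_space set"
  assumes "convex S" "continuous_map (top_of_set S) Y f"
  obtains g where "continuous_on S g" "g \<in> S \<rightarrow> X" "\<And>s. s \<in> S \<Longrightarrow> pr (g s) = f s"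
proof -
  obtain h where h: "continuous_on S h" "h \<in> S \<rightarrow> pullback S f" "\<And>s. s \<in> S \<Longrightarrow> fst (h s) = s"
    using covering_space_lift[OF covering_space_pullback[OF assms(2)] convex_imp_simply_connected[OF assms(1)]
        convex_imp_locally_path_connected[OF assms(1)] continuous_on_id] by auto
  have "snd (h s) \<in> X" "pr (snd (h s)) = f s" if "s \<in> S" for s
    using h(2) h(3)[OF that] that by (auto simp: pullback_def Pi_iff case_prod_beta simp del: set_eq_iff)
  then show ?thesis
    using continuous_on_snd[OF h(1)] by (intro that[of "\<lambda>s. snd (h s)"]) auto
qed

text \<open>The group element relating the two lifts is locally constant by the wandering condition,
  hence constant on the connected set \<open>S\<close>.\<close>

lemma lift_unique:
  fixes S :: "'s::euclidean_space set"
  assumes "convex S" and f: "continuous_on S f" "f \<in> S \<rightarrow> X" and f': "continuous_on S f'" "f' \<in> S \<rightarrow> X"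
    and eq: "\<And>s. s \<in> S \<Longrightarrow> pr (f s) = pr (f' s)"
  obtains g where "g \<in> carrier G" "\<And>s. s \<in> S \<Longrightarrow> f' s = act g (f s)"
proof -
  have "\<exists>g. \<forall>s\<in>S. g s \<in> carrier G \<and> f' s = act (g s) (f s)"
    using eq pr_eq_iff f(2) f'(2) by (intro bchoice) (metis Pi_iff)
  then obtain g where g: "\<And>s. s \<in> S \<Longrightarrow> g s \<in> carrier G" "\<And>s. s \<in> S \<Longrightarrow> f' s = act (g s) (f s)"
    by metis
  have "g constant_on S"
  proof (rule locally_constant_imp_constant)
    show "connected S" using assms(1) convex_connected by blast
    fix s assume s: "s \<in> S"
    obtain W where W: "openin (top_of_set X) W" "f' s \<in> W"
      and W1: "\<And>g y. \<lbrakk>g \<in> carrier G; y \<in> W; act g y \<in> W\<rbrakk> \<Longrightarrow> g = \<one>"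
      using wandering f'(2) s by (metis Pi_iff)
    let ?h = "\<lambda>t. act (g s) (f t)"
    \<comment> \<open>On this neighbourhood of \<open>s\<close> both \<open>f' t\<close> and
      \<open>?h t\<close> lie in \<open>W\<close>, and \<open>g t \<otimes> inv (g s)\<close>
      carries the second to the first.\<close>
    let ?U = "(S \<inter> f' -` W) \<inter> (S \<inter> ?h -` W)"
    have conth: "continuous_on S ?h"
      using continuous_on_compose2[OF act_cont[OF g(1)[OF s]] f(1)] f(2) by auto
    have "openin (top_of_set S) ?U"
      using f'(2) f(2) act_closed g(1)[OF s]
      by (intro openin_Int continuous_openin_preimage[OF f'(1) _ W(1)] continuous_openin_preimage[OF conth _ W(1)]) auto
    moreover have "s \<in> ?U" using s W(2) g(2)[OF s] by auto
    moreover have "g t = g s" if "t \<in> ?U" for t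
    proof -
      have t: "t \<in> S" "f t \<in> X" using that f(2) by auto
      have "act (g t \<otimes> inv (g s)) (?h t) = f' t"
        using t g s act_closed act_mult act_inv by simp
      then have "g t \<otimes> inv (g s) = \<one>" using W1[of "g t \<otimes> inv (g s)" "?h t"] that g(1) s t by auto
      then show ?thesis using g(1) s t by (metis inv_closed inv_equality inv_inv)
    qed
    ultimately show "\<exists>T. openin (top_of_set S) T \<and> s \<in> T \<and> (\<forall>y\<in>T. g y = g s)" by blast
  qed
  then obtain h where "\<forall>s\<in>S. g s = h" by (auto simp: constant_on_def)
  show ?thesis
  proof (cases "S = {}")
    case True
    then show ?thesis using that[OF one_closed] by auto
  next
    case False
    then show ?thesis using that[of h] g \<open>\<forall>s\<in>S. g s = h\<close> by auto
  qed
qed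

end

section \<open>The first homology group of the orbit space\<close>

definition vtx :: "nat \<Rightarrow> nat \<Rightarrow> real" where "vtx i = (\<lambda>j. if j = i then 1 else 0)"

lemma vtx_in_simplex [simp]: "vtx i \<in> standard_simplex p \<longleftrightarrow> i \<le> p"
  by (simp add: vtx_def)

lemma simplical_face_vtx: "simplical_face k (vtx i) = vtx (if i < k then i else Suc i)"
  by (auto simp: simplical_face_def vtx_def fun_eq_iff)

lemma standard_simplex_0_vtx: "standard_simplex 0 = {vtx 0}"
  by (simp add: standard_simplex_0 vtx_def)

lemma singular_face_vtx:
  "i \<le> p - Suc 0 \<Longrightarrow> singular_face p k f (vtx i) = f (vtx (if i < k then i else Suc i))"
  by (simp add: singular_face_def simplical_face_vtx)

lemma singular_simplex_top_of_set:
  "singular_simplex p (top_of_set X) f \<longleftrightarrow>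
     continuous_on (standard_simplex p) f \<and> f \<in> standard_simplex p \<rightarrow> X \<and> f \<in> extensional (standard_simplex p)"
  by (auto simp: singular_simplex_def euclidean_product_topology)

lemma singular_simplex_top_of_set_in:
  "\<lbrakk>singular_simplex p (top_of_set X) f; t \<in> standard_simplex p\<rbrakk> \<Longrightarrow> f t \<in> X"
  by (auto simp: singular_simplex_top_of_set)

definition pt :: "'a \<Rightarrow> (nat \<Rightarrow> real) \<Rightarrow> 'a" where "pt x = restrict (\<lambda>_. x) (standard_simplex 0)"

text \<open>Face 0 omits vertex 0, so the end point enters with the positive sign.\<close>

lemma chain_boundary_1: "chain_boundary 1 (frag_of f) = frag_of (pt (f (vtx 1))) - frag_of (pt (f (vtx 0)))"
proof -
  have "singular_face 1 k f = pt (f (vtx (if k = 0 then 1 else 0)))" if "k \<le> 1" for k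
  proof
    fix t
    show "singular_face 1 k f t = pt (f (vtx (if k = 0 then 1 else 0))) t"
      using that by (cases "t = vtx 0") (auto simp: singular_face_def pt_def standard_simplex_0_vtx simplical_face_vtx)
  qed
  then show ?thesis
    by (simp add: chain_boundary_of atMost_Suc)
qed

lemma chain_boundary_2:
  "chain_boundary 2 (frag_of f) =
     frag_of (singular_face 2 0 f) - frag_of (singular_face 2 1 f) + frag_of (singular_face 2 2 f)"
  by (simp add: chain_boundary_of numeral_2_eq_2 atMost_Suc)

definition seg :: "'a::real_vector \<Rightarrow> 'a \<Rightarrow> (nat \<Rightarrow> real) \<Rightarrow> 'a"
  where "seg x y = restrict (\<lambda>t. t 0 *\<^sub>R x + t 1 *\<^sub>R y) (standard_simplex 1)"

lemma seg_vtx [simp]: "seg x y (vtx 0) = x" "seg x y (vtx 1) = y"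
  by (simp_all add: seg_def) (simp_all add: vtx_def)

lemma standard_simplex_1D:
  "t \<in> standard_simplex 1 \<Longrightarrow> 0 \<le> t 0 \<and> 0 \<le> t 1 \<and> t 0 + t 1 = 1"
  by (auto simp: standard_simplex_def)

lemma singular_simplex_seg:
  fixes X :: "'a::euclidean_space set"
  assumes "convex X" "x \<in> X" "y \<in> X" shows "singular_simplex 1 (top_of_set X) (seg x y)"
proof -
  have c: "continuous_on (standard_simplex 1) (\<lambda>t::nat \<Rightarrow> real. t i)" for i
    by (rule continuous_on_subset[OF continuous_on_product_coordinates]) simp
  have "continuous_on (standard_simplex 1) (\<lambda>t. t 0 *\<^sub>R x + t 1 *\<^sub>R y)"
    by (intro continuous_intros c)
  then have "continuous_on (standard_simplex 1) (seg x y)"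
    by (rule continuous_on_eq) (simp add: seg_def)
  moreover have "seg x y \<in> standard_simplex 1 \<rightarrow> X"
    using assms standard_simplex_1D by (auto simp: seg_def convex_def)
  ultimately show ?thesis
    by (simp add: singular_simplex_top_of_set) (simp add: seg_def)
qed

text \<open>A convex set is contractible, so its reduced homology vanishes, and in degree 1 this is
  the ordinary homology.\<close>

lemma convex_cycle_imp_boundary:
  fixes X :: "'a::euclidean_space set"
  assumes "convex X" "singular_chain 1 (top_of_set X) c" "chain_boundary 1 c = 0"
  shows "singular_relboundary 1 (top_of_set X) {} c"
proof -
  have "trivial_group (reduced_homology_group 1 (top_of_set X))"
    by (intro trivial_reduced_homology_group_contractible_space) (simp add: assms(1) convex_imp_contractible)
  then have "trivial_group (homology_group (int 1) (top_of_set X))"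
    by (simp add: un_reduced_homology_group)
  moreover have "homologous_rel_set 1 (top_of_set X) {} c \<in> carrier (homology_group (int 1) (top_of_set X))"
    unfolding carrier_relative_homology_group using assms by (auto simp: singular_cycle)
  ultimately have "homologous_rel_set 1 (top_of_set X) {} c = \<one>\<^bsub>homology_group (int 1) (top_of_set X)\<^esub>"
    unfolding trivial_group_def by (metis singletonD)
  then show ?thesis
    by (simp only: one_relative_homology_group homologous_rel_set_eq_relboundary)
qed

text \<open>Simplices of dimension at most 2 are parametrised by convex subsets of the plane, since
  \<open>nat \<Rightarrow> real\<close> is not a normed space.\<close>

definition plane_to_simplex :: "real \<times> real \<Rightarrow> nat \<Rightarrow> real" where
  "plane_to_simplex p = (\<lambda>i. if i = 0 then 1 - fst p - snd p else if i = 1 then fst p else if i = 2 then snd p else 0)"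

abbreviation plane_simplex :: "nat \<Rightarrow> (real \<times> real) set" where
  "plane_simplex p \<equiv> (\<lambda>t. (t 1, t 2)) ` standard_simplex p"

lemma plane_to_simplex_inverse:
  assumes "p \<le> 2" "t \<in> standard_simplex p" shows "plane_to_simplex (t 1, t 2) = t"
proof
  fix i
  have s: "(\<Sum>i\<le>p. t i) = 1" "\<And>i. i > p \<Longrightarrow> t i = 0" using assms by (auto simp: standard_simplex_def)
  consider "p = 0" | "p = 1" | "p = 2" using assms(1) by linarith
  then have "t 0 + t 1 + t 2 = 1"
    by cases (use s in \<open>auto simp: numeral_2_eq_2 atMost_Suc\<close>)
  then show "plane_to_simplex (t 1, t 2) i = t i"
    using s(2)[of i] assms(1) by (auto simp: plane_to_simplex_def)
qed

lemma convex_plane_simplex: "convex (plane_simplex p)"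
proof (rule convexI)
  fix x y :: "real \<times> real" and u v :: real
  assume x: "x \<in> plane_simplex p" and y: "y \<in> plane_simplex p" and uv: "0 \<le> u" "0 \<le> v" "u + v = 1"
  obtain s t where st: "s \<in> standard_simplex p" "t \<in> standard_simplex p" "x = (s 1, s 2)" "y = (t 1, t 2)"
    using x y by auto
  have "(\<lambda>i. (1 - v) * s i + v * t i) \<in> standard_simplex p"
    using st uv by (intro convex_standard_simplex) auto
  moreover have "1 - v = u" using uv by simp
  ultimately show "u *\<^sub>R x + v *\<^sub>R y \<in> plane_simplex p"
    using st by (auto simp: image_iff intro!: bexI[of _ "\<lambda>i. u * s i + v * t i"])
qed

lemma continuous_on_plane_to_simplex: "continuous_on S plane_to_simplex"
proof (rule continuous_on_coordinatewise_then_product)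
  show "continuous_on S (\<lambda>p. plane_to_simplex p i)" for i
    unfolding plane_to_simplex_def by (cases "i = 0"; cases "i = 1"; cases "i = 2") (auto intro!: continuous_intros)
qed

lemma continuous_on_simplex_to_plane: "continuous_on S (\<lambda>t::nat \<Rightarrow> real. (t 1, t 2))"
  by (intro continuous_on_Pair continuous_on_subset[OF continuous_on_product_coordinates]) auto

section \<open>Lifted simplices and their deck elements\<close>

context free_affine_action
begin

text \<open>The simplex is carried to a convex subset of the plane, lifted there by
  \<open>lift_exists\<close>, and carried back.\<close>

lemma lift_simplex:
  assumes "p \<le> 2" "singular_simplex p Y f"
  obtains f' where "singular_simplex p (top_of_set X) f'" "simplex_map p pr f' = f"
proof -
  have e: "plane_to_simplex \<in> plane_simplex p \<rightarrow> standard_simplex p"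
    using plane_to_simplex_inverse[OF assms(1)] by auto
  have f: "continuous_map (top_of_set (standard_simplex p)) Y f" "f \<in> extensional (standard_simplex p)"
    using assms(2) by (auto simp: singular_simplex_def euclidean_product_topology)
  have "continuous_map (top_of_set (plane_simplex p)) (top_of_set (standard_simplex p)) plane_to_simplex"
    using e by (auto simp: continuous_on_plane_to_simplex)
  then have "continuous_map (top_of_set (plane_simplex p)) Y (f \<circ> plane_to_simplex)"
    using f(1) continuous_map_compose by blast
  then obtain g where g: "continuous_on (plane_simplex p) g" "g \<in> plane_simplex p \<rightarrow> X"
    "\<And>s. s \<in> plane_simplex p \<Longrightarrow> pr (g s) = (f \<circ> plane_to_simplex) s"
    by (rule lift_exists[OF convex_plane_simplex]) (rule that)
  define f' where "f' = restrict (\<lambda>t. g (t 1, t 2)) (standard_simplex p)"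
  have "continuous_on (standard_simplex p) (\<lambda>t. g (t 1, t 2))"
    by (rule continuous_on_compose2[OF g(1) continuous_on_simplex_to_plane]) auto
  then have "continuous_on (standard_simplex p) f'"
    by (rule continuous_on_eq) (simp add: f'_def)
  moreover have "f' \<in> standard_simplex p \<rightarrow> X" using g(2) by (auto simp: f'_def)
  ultimately have "singular_simplex p (top_of_set X) f'"
    by (simp add: singular_simplex_top_of_set) (simp add: f'_def)
  moreover have "simplex_map p pr f' = f"
  proof
    fix t
    show "simplex_map p pr f' t = f t"
    proof (cases "t \<in> standard_simplex p")
      case True
      then have "pr (g (t 1, t 2)) = f t"
        using g(3)[OF imageI[OF True]] unfolding comp_apply plane_to_simplex_inverse[OF assms(1) True] by blast
      then show ?thesis using True by (simp only: simplex_map_def f'_def restrict_apply comp_apply if_True)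
    next
      case False
      \<comment> \<open>Singular simplices are extensional, so off the standard simplex both sides
        take the default value.\<close>
      have "simplex_map p pr f' t = undefined" unfolding simplex_map_def using False by (simp only: restrict_apply if_False)
      then show ?thesis using extensional_arb[OF f(2) False] by (rule trans[OF _ sym])
    qed
  qed
  ultimately show ?thesis using that by blast
qed

lemma lift_simplex_unique:
  assumes "p \<le> 2" "singular_simplex p (top_of_set X) f" "singular_simplex p (top_of_set X) f'"
    and eq: "simplex_map p pr f = simplex_map p pr f'"
  obtains g where "g \<in> carrier G" "\<And>t. t \<in> standard_simplex p \<Longrightarrow> f' t = act g (f t)"
proof -
  let ?S = "plane_simplex p"
  have e: "plane_to_simplex ` ?S \<subseteq> standard_simplex p"
    using plane_to_simplex_inverse[OF assms(1)] by auto
  have c: "continuous_on ?S (h \<circ> plane_to_simplex) \<and> h \<circ> plane_to_simplex \<in> ?S \<rightarrow> X"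
    if "singular_simplex p (top_of_set X) h" for h
  proof
    show "continuous_on ?S (h \<circ> plane_to_simplex)"
      using that continuous_on_subset[OF _ e]
      by (intro continuous_on_compose continuous_on_plane_to_simplex) (auto simp: singular_simplex_top_of_set)
    show "h \<circ> plane_to_simplex \<in> ?S \<rightarrow> X"
      using that e by (simp add: singular_simplex_top_of_set Pi_iff image_subset_iff)
  qed
  have pr_eq: "pr (f t) = pr (f' t)" if "t \<in> standard_simplex p" for t
    using fun_cong[OF eq, of t] that by (simp only: simplex_map_def restrict_apply comp_apply if_True)
  have "pr ((f \<circ> plane_to_simplex) s) = pr ((f' \<circ> plane_to_simplex) s)" if "s \<in> ?S" for s
    unfolding comp_apply by (rule pr_eq) (use e that in blast)
  then obtain g where g: "g \<in> carrier G" "\<And>s. s \<in> ?S \<Longrightarrow> (f' \<circ> plane_to_simplex) s = act g ((f \<circ> plane_to_simplex) s)"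
    by (rule lift_unique[OF convex_plane_simplex conjunct1[OF c[OF assms(2)]] conjunct2[OF c[OF assms(2)]]
          conjunct1[OF c[OF assms(3)]] conjunct2[OF c[OF assms(3)]]]) (assumption, rule that)
  have "f' t = act g (f t)" if t: "t \<in> standard_simplex p" for t
    using g(2)[OF imageI[OF t]] unfolding comp_apply plane_to_simplex_inverse[OF assms(1) t] .
  then show ?thesis using that g(1) by blast
qed

text \<open>The base point \<open>SOME y. y \<in> pr x\<close> depends only on the set
  \<open>pr x\<close>, so all points of an orbit are measured from the same representative. Freeness
  makes the group element unique.\<close>

definition coord :: "'x \<Rightarrow> 'a" where
  "coord x = (THE g. g \<in> carrier G \<and> x = act g (SOME y. y \<in> pr x))"

lemma coord:
  assumes "x \<in> X"
  shows coord_closed: "coord x \<in> carrier G" and act_coord: "x = act (coord x) (SOME y. y \<in> pr x)"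
proof -
  define y where "y = (SOME y. y \<in> pr x)"
  have "y \<in> pr x" unfolding y_def using pr_self[OF assms] by (rule someI)
  then obtain h where h: "h \<in> carrier G" "y = act h x" unfolding orbit_def by auto
  then have y: "y \<in> X" and x: "inv h \<in> carrier G \<and> x = act (inv h) y" using act_inv act_closed assms by auto
  have "coord x \<in> carrier G \<and> x = act (coord x) y"
    unfolding coord_def y_def[symmetric] by (rule theI[where P = "\<lambda>g. g \<in> carrier G \<and> x = act g y", OF x]) (use act_cancel y x in metis)
  then show "coord x \<in> carrier G" "x = act (coord x) (SOME y. y \<in> pr x)" unfolding y_def by blast+
qed

text \<open>Both sides carry the representative of the common orbit to \<open>act g x\<close>, and
  the action is free.\<close>

lemma coord_act:
  assumes "g \<in> carrier G" "x \<in> X" shows "coord (act g x) = g \<otimes> coord x"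
proof -
  let ?y = "SOME y. y \<in> pr x"
  have y: "?y \<in> X"
    using someI[of "\<lambda>y. y \<in> pr x", OF pr_self[OF assms(2)]] act_closed assms(2) unfolding orbit_def by auto
  have "act g x = act (coord (act g x)) ?y"
    using act_coord[OF act_closed[OF assms]] pr_act[OF assms] by metis
  moreover have "act g x = act (g \<otimes> coord x) ?y"
    using act_mult[OF assms(1) coord_closed[OF assms(2)] y] act_coord[OF assms(2)] by metis
  ultimately show ?thesis
    using act_cancel y coord_closed act_closed assms by (metis m_closed)
qed

text \<open>The holonomy of a path relative to the chosen orbit representatives.\<close>

definition deck :: "((nat \<Rightarrow> real) \<Rightarrow> 'x) \<Rightarrow> 'a" where
  "deck f = inv (coord (f (vtx 0))) \<otimes> coord (f (vtx 1))"

lemma deck_closed: "singular_simplex 1 (top_of_set X) f \<Longrightarrow> deck f \<in> carrier G"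
  unfolding deck_def by (intro m_closed inv_closed coord_closed) (auto intro: singular_simplex_top_of_set_in)

definition deckY :: "((nat \<Rightarrow> real) \<Rightarrow> 'x set) \<Rightarrow> 'a" where
  "deckY s = deck (SOME f. singular_simplex 1 (top_of_set X) f \<and> simplex_map 1 pr f = s)"

text \<open>Two lifts differ by one translation, which cancels between the coordinates of the end
  points, so the choice of lift is immaterial.\<close>

lemma deckY_simplex_map:
  assumes "singular_simplex 1 (top_of_set X) f" shows "deckY (simplex_map 1 pr f) = deck f"
proof -
  define f' where "f' = (SOME h. singular_simplex 1 (top_of_set X) h \<and> simplex_map 1 pr h = simplex_map 1 pr f)"
  have f': "singular_simplex 1 (top_of_set X) f'" "simplex_map 1 pr f' = simplex_map 1 pr f"
    using someI[of "\<lambda>h. singular_simplex 1 (top_of_set X) h \<and> simplex_map 1 pr h = simplex_map 1 pr f" f] assms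
    unfolding f'_def by blast+
  obtain g where g: "g \<in> carrier G" "\<And>t. t \<in> standard_simplex 1 \<Longrightarrow> f' t = act g (f t)"
    using lift_simplex_unique[OF _ assms f'(1) f'(2)[symmetric]] by auto
  have "f (vtx i) \<in> X" if "i \<le> 1" for i
    using singular_simplex_top_of_set_in[OF assms] that by simp
  then have v: "f (vtx 0) \<in> X" "f (vtx 1) \<in> X" by auto
  have "deck f' = inv (g \<otimes> coord (f (vtx 0))) \<otimes> (g \<otimes> coord (f (vtx 1)))"
    using g(2)[of "vtx 0"] g(2)[of "vtx 1"] coord_act[OF g(1)] v by (simp add: deck_def)
  also have "\<dots> = deck f"
    using g(1) coord_closed[OF v(1)] coord_closed[OF v(2)]
    by (simp add: deck_def inv_mult_group m_assoc) (simp add: m_assoc[symmetric])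
  finally have "deck f' = deck f" .
  then show ?thesis unfolding deckY_def f'_def by blast
qed

lemma deckY_closed:
  assumes "singular_simplex 1 Y s" shows "deckY s \<in> carrier G"
proof -
  obtain f where f: "singular_simplex 1 (top_of_set X) f" "simplex_map 1 pr f = s"
    by (rule lift_simplex[OF _ assms]) (simp, rule that)
  then show ?thesis
    using deckY_simplex_map[OF f(1)] deck_closed[OF f(1)] by (simp only: f(2))
qed

text \<open>A cocycle identity: if \<open>c_i\<close> is the coordinate of vertex i, the faces 2, 0
  and 1 have deck elements \<open>inv c_0 \<otimes> c_1\<close>,
  \<open>inv c_1 \<otimes> c_2\<close> and \<open>inv c_0 \<otimes> c_2\<close>.\<close>

lemma deck_faces:
  assumes "singular_simplex 2 (top_of_set X) f"
  shows "deck (singular_face 2 1 f) = deck (singular_face 2 2 f) \<otimes> deck (singular_face 2 0 f)"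
proof -
  have v: "f (vtx i) \<in> X" if "i \<le> 2" for i
    using singular_simplex_top_of_set_in[OF assms] that by simp
  let ?c = "\<lambda>i. coord (f (vtx i))"
  have c: "?c 0 \<in> carrier G" "?c 1 \<in> carrier G" "?c 2 \<in> carrier G" using v coord_closed by auto
  have "deck (singular_face 2 1 f) = inv (?c 0) \<otimes> ?c 2" "deck (singular_face 2 2 f) = inv (?c 0) \<otimes> ?c 1"
    "deck (singular_face 2 0 f) = inv (?c 1) \<otimes> ?c 2"
    by (simp_all add: deck_def singular_face_vtx numeral_2_eq_2)
  moreover have "inv a \<otimes> b \<otimes> (inv b \<otimes> d) = inv a \<otimes> d"
    if "a \<in> carrier G" "b \<in> carrier G" "d \<in> carrier G" for a b d
    using that by (metis inv_closed l_one m_assoc m_closed r_inv)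
  ultimately show ?thesis
    using c by metis
qed

end

text \<open>The product of two classes is by construction the set of all sums of their members, and
  these sums fill the class of \<open>a + b\<close>.\<close>

lemma mult_homology_group:
  assumes "singular_relcycle p X S a" "singular_relcycle p X S b"
  shows "homologous_rel_set p X S a \<otimes>\<^bsub>relative_homology_group (int p) X S\<^esub> homologous_rel_set p X S b
    = homologous_rel_set p X S (a + b)"
proof -
  have "(\<Union>r\<in>homologous_rel_set p X S a. \<Union>s\<in>homologous_rel_set p X S b. {r + s}) = homologous_rel_set p X S (a + b)"
  proof (intro equalityI subsetI)
    fix x assume "x \<in> (\<Union>r\<in>homologous_rel_set p X S a. \<Union>s\<in>homologous_rel_set p X S b. {r + s})"
    then show "x \<in> homologous_rel_set p X S (a + b)" using homologous_rel_add by fastforce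
  next
    fix x assume "x \<in> homologous_rel_set p X S (a + b)"
    then have "homologous_rel p X S (a + b - b) (x - b)"
      by (intro homologous_rel_diff) auto
    then have "x - b \<in> homologous_rel_set p X S a" "b \<in> homologous_rel_set p X S b" "x = (x - b) + b" by auto
    then show "x \<in> (\<Union>r\<in>homologous_rel_set p X S a. \<Union>s\<in>homologous_rel_set p X S b. {r + s})" by blast
  qed
  then show ?thesis by (simp add: mult_relative_homology_group)
qed

section \<open>From group elements to homology classes\<close>

context free_affine_action
begin

abbreviation "prs \<equiv> simplex_map 1 pr"

lemma singular_simplex_prs: "singular_simplex 1 (top_of_set X) f \<Longrightarrow> singular_simplex 1 Y (prs f)"
  using singular_simplex_simplex_map continuous_map_pr by blast

lemma prs_vtx: "i \<le> 1 \<Longrightarrow> prs f (vtx i) = pr (f (vtx i))"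
  unfolding simplex_map_def by simp

text \<open>By affinity the two segments differ pointwise by the action of \<open>g\<close>.\<close>

lemma prs_seg_act:
  assumes "g \<in> carrier G" "x \<in> X" "y \<in> X" shows "prs (seg (act g x) (act g y)) = prs (seg x y)"
proof
  fix t
  show "prs (seg (act g x) (act g y)) t = prs (seg x y) t"
  proof (cases "t \<in> standard_simplex 1")
    case True
    note t = standard_simplex_1D[OF True]
    have z: "t 0 *\<^sub>R x + t 1 *\<^sub>R y \<in> X" using t assms convex_X by (auto simp: convex_def)
    have "seg (act g x) (act g y) t = act g (seg x y t)" "seg x y t \<in> X"
      using act_affine[OF assms, of "t 0" "t 1"] t True z by (simp_all add: seg_def)
    then have "pr (seg (act g x) (act g y) t) = pr (seg x y t)" using pr_act[OF assms(1)] by metis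
    then show ?thesis using True unfolding simplex_map_def by (simp only: restrict_apply comp_apply if_True)
  next
    case False
    then show ?thesis unfolding simplex_map_def by (simp only: restrict_apply if_False)
  qed
qed

text \<open>The source of the homologies below: each is the image of a 1-cycle drawn in the convex
  set, where it bounds.\<close>

lemma cycle_boundary_pr:
  assumes "singular_chain 1 (top_of_set X) c" "chain_boundary 1 c = 0"
  shows "singular_relboundary 1 Y {} (chain_map 1 pr c)"
  by (rule singular_relboundary_chain_map[OF convex_cycle_imp_boundary[OF convex_X assms] continuous_map_pr]) simp

definition x0 :: 'x where "x0 = (SOME x. x \<in> X)"

lemma x0_in: "x0 \<in> X" using nonempty_X unfolding x0_def by (simp add: some_in_eq)

definition loop :: "'a \<Rightarrow> 'x set chain" where "loop g = frag_of (prs (seg x0 (act g x0)))"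

text \<open>Translation by \<open>inv g\<close> moves the segment to one that starts at
  \<open>x0\<close>.\<close>

lemma loop_eq:
  assumes "g \<in> carrier G" "h \<in> carrier G"
  shows "frag_of (prs (seg (act g x0) (act h x0))) = loop (inv g \<otimes> h)"
  using prs_seg_act[of "inv g" "act g x0" "act h x0"] assms x0_in act_closed act_inv act_mult
  by (simp add: loop_def)

lemma seg_simplex: "\<lbrakk>x \<in> X; y \<in> X\<rbrakk> \<Longrightarrow> singular_simplex 1 (top_of_set X) (seg x y)"
  using singular_simplex_seg[OF convex_X] .

lemma loop_cycle:
  assumes "g \<in> carrier G" shows "singular_relcycle 1 Y {} (loop g)"
proof -
  have "singular_simplex 1 Y (prs (seg x0 (act g x0)))"
    using singular_simplex_prs seg_simplex x0_in act_closed assms by blast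
  moreover have "pr x0 = pr (act g x0)" using pr_act[OF assms x0_in] by blast
  then have "chain_boundary 1 (loop g) = 0"
    unfolding loop_def chain_boundary_1 prs_vtx[OF order_refl] prs_vtx[OF zero_le_one] seg_vtx
    by (simp only: diff_self)
  ultimately show ?thesis unfolding singular_cycle loop_def singular_chain_of by blast
qed

lemma loop_mult:
  assumes "g \<in> carrier G" "h \<in> carrier G"
  shows "homologous_rel 1 Y {} (loop (g \<otimes> h)) (loop g + loop h)"
proof -
  \<comment> \<open>The triangle on \<open>x0\<close> and its translates by \<open>g\<close> and
    \<open>g \<otimes> h\<close>; its second edge is a translate of the segment defining
    \<open>loop h\<close>.\<close>
  let ?c = "frag_of (seg x0 (act g x0)) + frag_of (seg (act g x0) (act (g \<otimes> h) x0)) - frag_of (seg x0 (act (g \<otimes> h) x0))"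
  have in_X: "act g x0 \<in> X" "act (g \<otimes> h) x0 \<in> X" using assms act_closed x0_in by auto
  have "singular_relboundary 1 Y {} (chain_map 1 pr ?c)"
    using seg_simplex x0_in in_X
    by (intro cycle_boundary_pr singular_chain_diff singular_chain_add)
      (simp_all add: singular_chain_of chain_boundary_diff chain_boundary_add chain_boundary_1[simplified] seg_vtx[simplified])
  moreover have "chain_map 1 pr ?c = loop g + loop (inv g \<otimes> (g \<otimes> h)) - loop (g \<otimes> h)"
    using loop_eq[OF assms(1) m_closed[OF assms]] by (simp add: chain_map_diff chain_map_add loop_def)
  moreover have "inv g \<otimes> (g \<otimes> h) = h" using assms by (simp add: m_assoc[symmetric])
  ultimately have "homologous_rel 1 Y {} (loop g + loop h) (loop (g \<otimes> h))"
    by (simp add: homologous_rel_def)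
  then show ?thesis by (simp only: homologous_rel_sym)
qed

text \<open>The case of two trivial factors in \<open>loop_mult\<close> makes this loop homologous
  to its own double.\<close>

lemma loop_one: "homologous_rel 1 Y {} (loop \<one>) 0"
  using loop_mult[OF one_closed one_closed] homologous_rel_sym[of 1 Y "{}" "loop \<one>"]
  by (simp add: homologous_rel_def)

lemma loop_diff:
  assumes "g \<in> carrier G" "h \<in> carrier G"
  shows "homologous_rel 1 Y {} (loop g - loop h) (loop (g \<otimes> inv h))"
proof -
  have "homologous_rel 1 Y {} (loop g) (loop (g \<otimes> inv h) + loop h)"
    using loop_mult[of "g \<otimes> inv h" h] assms by (simp add: m_assoc)
  then show ?thesis by (simp add: homologous_rel_def algebra_simps)
qed

text \<open>The path that joins \<open>x\<close> to the translate of \<open>x0\<close> lying in the same sheet as \<open>x\<close>.\<close>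

definition tail :: "'x \<Rightarrow> 'x set chain" where "tail x = frag_of (prs (seg (act (coord x) x0) x))"

text \<open>By \<open>coord_act\<close> both end points of the path are translated by
  \<open>g\<close>, so its image is unchanged.\<close>

lemma tail_act:
  assumes "g \<in> carrier G" "x \<in> X" shows "tail (act g x) = tail x"
proof -
  have "act (coord (act g x)) x0 = act g (act (coord x) x0)"
    using coord_act[OF assms] act_mult coord_closed assms x0_in by simp
  then show ?thesis
    unfolding tail_def using prs_seg_act[OF assms(1) act_closed[OF coord_closed[OF assms(2)] x0_in] assms(2)] by simp
qed

text \<open>Taking 0-simplices as arguments lets \<open>frag_extend\<close> turn the correction into
  a homomorphism on 0-chains.\<close>

definition tailY :: "((nat \<Rightarrow> real) \<Rightarrow> 'x set) \<Rightarrow> 'x set chain" where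
  "tailY s = tail (SOME x. x \<in> X \<and> pr x = s (vtx 0))"

lemma tailY_pt:
  assumes "x \<in> X" shows "tailY (pt (pr x)) = tail x"
proof -
  define y where "y = (SOME y. y \<in> X \<and> pr y = pr x)"
  have "y \<in> X \<and> pr y = pr x" unfolding y_def by (rule someI[of _ x]) (use assms in blast)
  then have "\<exists>g\<in>carrier G. y = act g x" using pr_eq_iff[OF assms, of y] by metis
  then have "tail y = tail x" using tail_act assms by auto
  moreover have "pt (pr x) (vtx 0) = pr x" unfolding pt_def by simp
  ultimately show ?thesis unfolding tailY_def y_def by (simp only:)
qed

lemma simplex_homologous_loop:
  assumes "singular_simplex 1 Y s"
  shows "homologous_rel 1 Y {} (frag_of s - frag_extend tailY (chain_boundary 1 (frag_of s))) (loop (deckY s))"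
proof -
  obtain f where f: "singular_simplex 1 (top_of_set X) f" "prs f = s"
    by (rule lift_simplex[OF _ assms]) (simp, rule that)
  define x y where "x = f (vtx 0)" and "y = f (vtx 1)"
  have xy: "x \<in> X" "y \<in> X" using singular_simplex_top_of_set_in[OF f(1)] by (simp_all add: x_def y_def)
  define a b where "a = act (coord x) x0" and "b = act (coord y) x0"
  have ab: "a \<in> X" "b \<in> X" using act_closed coord_closed xy x0_in by (simp_all add: a_def b_def)
  \<comment> \<open>A quadrilateral: from \<open>a\<close> through \<open>x\<close> along
    \<open>f\<close> to \<open>y\<close>, against the way from \<open>a\<close> through
    \<open>b\<close> to \<open>y\<close>. The side from \<open>a\<close> to \<open>b\<close> joins
    translates of \<open>x0\<close> and so becomes a loop.\<close>
  let ?c = "frag_of f + frag_of (seg a x) - frag_of (seg b y) - frag_of (seg a b)"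
  have "singular_relboundary 1 Y {} (chain_map 1 pr ?c)"
    using seg_simplex ab xy f(1)
    by (intro cycle_boundary_pr singular_chain_diff singular_chain_add)
      (simp_all add: singular_chain_of chain_boundary_diff chain_boundary_add chain_boundary_1[simplified] seg_vtx[simplified]
        flip: x_def y_def[simplified])
  moreover have "frag_of (prs (seg a b)) = loop (deckY s)"
    using loop_eq[OF coord_closed[OF xy(1)] coord_closed[OF xy(2)]] deckY_simplex_map[OF f(1)]
    unfolding f(2) a_def b_def deck_def x_def y_def by (simp only:)
  then have "chain_map 1 pr ?c = frag_of s + tail x - tail y - loop (deckY s)"
    unfolding chain_map_diff chain_map_add chain_map_of f(2) tail_def a_def b_def by (simp only:)
  moreover have "frag_extend tailY (chain_boundary 1 (frag_of s)) = tail y - tail x"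
    unfolding chain_boundary_1 frag_extend_diff frag_extend_of f(2)[symmetric]
      prs_vtx[OF order_refl] prs_vtx[OF zero_le_one] x_def[symmetric] y_def[symmetric] tailY_pt[OF xy(1)] tailY_pt[OF xy(2)] ..
  ultimately show ?thesis
    unfolding homologous_rel_def by (simp only: diff_diff_eq2 diff_add_eq)
qed

text \<open>The correction term makes the claim additive in the chain, so it extends from simplices
  to all chains. On cycles the correction vanishes, which gives surjectivity of
  \<open>loop_class\<close>.\<close>

lemma chain_homologous_loop:
  assumes "singular_chain 1 Y c"
  shows "\<exists>g\<in>carrier G. homologous_rel 1 Y {} (c - frag_extend tailY (chain_boundary 1 c)) (loop g)"
  using assms unfolding singular_chain_def
proof (induction rule: frag_induction)
  case zero
  then show ?case using loop_one homologous_rel_sym by (intro bexI[of _ \<one>]) fastforce+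
next
  case (one s)
  then show ?case using simplex_homologous_loop deckY_closed by blast
next
  case (diff a b)
  then obtain g h where gh: "g \<in> carrier G" "h \<in> carrier G"
    "homologous_rel 1 Y {} (a - frag_extend tailY (chain_boundary 1 a)) (loop g)"
    "homologous_rel 1 Y {} (b - frag_extend tailY (chain_boundary 1 b)) (loop h)" by blast
  have "homologous_rel 1 Y {} (a - b - frag_extend tailY (chain_boundary 1 (a - b))) (loop g - loop h)"
    using homologous_rel_diff[OF gh(3,4)] by (simp add: chain_boundary_diff frag_extend_diff algebra_simps)
  then show ?case
    using homologous_rel_trans[OF loop_diff[OF gh(1,2)]] gh(1,2) by (intro bexI[of _ "g \<otimes> inv h"]) auto
qed

definition loop_class :: "'a \<Rightarrow> 'x set chain set" where
  "loop_class g = homologous_rel_set 1 Y {} (loop g)"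

lemma loop_class_hom: "loop_class \<in> hom G (homology_group 1 Y)"
proof (rule homI)
  fix g assume "g \<in> carrier G"
  then have "loop_class g \<in> carrier (homology_group (int 1) Y)"
    unfolding loop_class_def carrier_relative_homology_group using loop_cycle by blast
  then show "loop_class g \<in> carrier (homology_group 1 Y)" by simp
next
  fix g h assume gh: "g \<in> carrier G" "h \<in> carrier G"
  have "loop_class g \<otimes>\<^bsub>homology_group (int 1) Y\<^esub> loop_class h = homologous_rel_set 1 Y {} (loop g + loop h)"
    unfolding loop_class_def by (rule mult_homology_group) (use loop_cycle gh in auto)
  also have "\<dots> = loop_class (g \<otimes> h)"
    unfolding loop_class_def homologous_rel_set_eq using loop_mult[OF gh] homologous_rel_sym by metis
  finally show "loop_class (g \<otimes> h) = loop_class g \<otimes>\<^bsub>homology_group 1 Y\<^esub> loop_class h" by simp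
qed

lemma loop_class_surj: "loop_class ` carrier G = carrier (homology_group 1 Y)"
proof (intro equalityI subsetI)
  fix k assume "k \<in> loop_class ` carrier G"
  then show "k \<in> carrier (homology_group 1 Y)" using loop_class_hom by (auto simp: hom_def)
next
  fix k assume "k \<in> carrier (homology_group 1 Y)"
  then have "k \<in> carrier (homology_group (int 1) Y)" by simp
  then obtain c where c: "singular_relcycle 1 Y {} c" "k = homologous_rel_set 1 Y {} c"
    unfolding carrier_relative_homology_group by blast
  then have c': "singular_chain 1 Y c" "chain_boundary 1 c = 0" by (simp_all only: singular_cycle)
  obtain g where "g \<in> carrier G" "homologous_rel 1 Y {} c (loop g)"
    using chain_homologous_loop[OF c'(1)] unfolding c'(2) by auto
  then show "k \<in> loop_class ` carrier G"
    unfolding c(2) loop_class_def by (intro image_eqI[of _ _ g]) (simp_all only: homologous_rel_set_eq)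
qed

section \<open>The kernel of the loop map\<close>

text \<open>Sending a 1-simplex to \<open>\<eta>\<close> of its deck element extends to a
  homomorphism \<open>\<Psi>\<close> on 1-chains. By \<open>deck_faces\<close> it kills boundaries
  of 2-simplices, while its value on \<open>loop g\<close> is \<open>\<eta> g\<close>.\<close>

lemma loop_boundary_imp_kernel:
  assumes "comm_group A" "\<eta> \<in> hom G A" "g \<in> carrier G" "singular_relboundary 1 Y {} (loop g)"
  shows "\<eta> g = \<one>\<^bsub>A\<^esub>"
proof -
  interpret A: comm_group A by fact
  interpret \<eta>: group_hom G A \<eta> using assms(2) by unfold_locales
  have "(\<lambda>s. \<eta> (deckY s)) ` singular_simplex_set 1 Y \<subseteq> carrier A"
    using deckY_closed by auto
  then obtain \<Psi> where \<Psi>: "\<Psi> \<in> hom (free_Abelian_group (singular_simplex_set 1 Y)) A"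
    "\<And>s. s \<in> singular_simplex_set 1 Y \<Longrightarrow> \<Psi> (frag_of s) = \<eta> (deckY s)"
    by (rule A.free_Abelian_group_universal) (rule that)
  interpret \<Psi>: group_hom "chain_group 1 Y" A \<Psi>
    using \<Psi>(1) by (intro group_hom.intro group_hom_axioms.intro group_chain_group A.is_group) (simp add: chain_group_def)
  have \<Psi>_diff: "\<Psi> (a - b) = \<Psi> a \<otimes>\<^bsub>A\<^esub> inv\<^bsub>A\<^esub> \<Psi> b" and \<Psi>_add: "\<Psi> (a + b) = \<Psi> a \<otimes>\<^bsub>A\<^esub> \<Psi> b"
    if "singular_chain 1 Y a" "singular_chain 1 Y b" for a b
  proof -
    show "\<Psi> (a + b) = \<Psi> a \<otimes>\<^bsub>A\<^esub> \<Psi> b" using \<Psi>.hom_mult[of a b] that by simp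
    have "\<Psi> (- b) = inv\<^bsub>A\<^esub> \<Psi> b" "singular_chain 1 Y (- b)"
      using \<Psi>.hom_inv[of b] m_inv_chain_group[of b 1 Y] that by (simp_all add: singular_chain_def)
    then show "\<Psi> (a - b) = \<Psi> a \<otimes>\<^bsub>A\<^esub> inv\<^bsub>A\<^esub> \<Psi> b"
      using \<Psi>.hom_mult[of a "- b"] that by simp
  qed
  have "singular_chain 1 Y (chain_boundary 2 d) \<and> \<Psi> (chain_boundary 2 d) = \<one>\<^bsub>A\<^esub>" if "singular_chain 2 Y d" for d
    using that unfolding singular_chain_def[of 2]
  proof (induction rule: frag_induction)
    case zero
    then show ?case using \<Psi>.hom_one by simp
  next
    case (one s)
    then have s: "singular_simplex 2 Y s" by simp
    obtain f where f: "singular_simplex 2 (top_of_set X) f" "simplex_map 2 pr f = s"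
      by (rule lift_simplex[OF _ s]) (simp, rule that)
    have face: "singular_simplex 1 (top_of_set X) (singular_face 2 k f)" "singular_face 2 k s = prs (singular_face 2 k f)"
      if "k \<le> 2" for k
    proof -
      show "singular_simplex 1 (top_of_set X) (singular_face 2 k f)"
        using singular_simplex_singular_face[OF f(1), of k] that by simp
      have "prs (singular_face 2 k f) = prs (f \<circ> simplical_face k)"
        unfolding singular_face_def simplex_map_def by (simp add: fun_eq_iff)
      then show "singular_face 2 k s = prs (singular_face 2 k f)"
        using singular_face_simplex_map[of 2 k pr f] that unfolding f(2) by simp
    qed
    have \<Psi>f: "\<Psi> (frag_of (singular_face 2 k s)) = \<eta> (deck (singular_face 2 k f))"
      and ch: "singular_chain 1 Y (frag_of (singular_face 2 k s))" 
      and dc: "deck (singular_face 2 k f) \<in> carrier G" if "k \<le> 2" for k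
      using face[OF that] \<Psi>(2)[of "singular_face 2 k s"] deckY_simplex_map[OF face(1)[OF that]]
        singular_simplex_prs[OF face(1)[OF that]] deck_closed[OF face(1)[OF that]]
      by (simp_all only: singular_chain_of mem_Collect_eq)
    have d: "deck (singular_face 2 k f) \<in> carrier G" if "k = 0 \<or> k = 1 \<or> k = 2" for k
      by (rule dc) (use that in auto)
    have "\<Psi> (chain_boundary 2 (frag_of s)) = \<eta> (deck (singular_face 2 0 f)) \<otimes>\<^bsub>A\<^esub>
        inv\<^bsub>A\<^esub> \<eta> (deck (singular_face 2 1 f)) \<otimes>\<^bsub>A\<^esub> \<eta> (deck (singular_face 2 2 f))"
      using ch by (simp add: chain_boundary_2 \<Psi>_add \<Psi>_diff singular_chain_diff \<Psi>f)
    also have "\<dots> = \<one>\<^bsub>A\<^esub>"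
      using d unfolding deck_faces[OF f(1)]
      by (simp add: A.inv_mult A.m_ac)
    finally show ?case
      using ch by (simp add: chain_boundary_2 singular_chain_add singular_chain_diff)
  next
    case (diff a b)
    then show ?case by (simp add: chain_boundary_diff singular_chain_diff \<Psi>_diff)
  qed
  moreover obtain d where "singular_chain 2 Y d" "chain_boundary 2 d = loop g"
    using assms(4) unfolding singular_boundary by (auto simp: numeral_2_eq_2)
  ultimately have "\<Psi> (loop g) = \<one>\<^bsub>A\<^esub>" by metis
  moreover have "\<Psi> (loop g) = \<eta> (deck (seg x0 (act g x0)))"
    unfolding loop_def
    using \<Psi>(2) singular_simplex_prs deckY_simplex_map seg_simplex[OF x0_in act_closed[OF assms(3) x0_in]] by (metis mem_Collect_eq)
  moreover have "\<eta> (deck (seg x0 (act g x0))) = \<eta> g"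
  proof -
    \<comment> \<open>The deck element is only a conjugate of \<open>g\<close>, because
      \<open>x0\<close> may differ from the representative of its orbit; the abelian target does not
      see the conjugation.\<close>
    have "deck (seg x0 (act g x0)) = inv (coord x0) \<otimes> (g \<otimes> coord x0)"
      unfolding deck_def seg_vtx coord_act[OF assms(3) x0_in] ..
    moreover have "\<eta> (inv (coord x0) \<otimes> (g \<otimes> coord x0)) = inv\<^bsub>A\<^esub> \<eta> (coord x0) \<otimes>\<^bsub>A\<^esub> (\<eta> g \<otimes>\<^bsub>A\<^esub> \<eta> (coord x0))"
      using coord_closed[OF x0_in] assms(3) by simp
    moreover have "\<dots> = \<eta> g"
      using coord_closed[OF x0_in] assms(3) by (simp add: A.m_comm[of "\<eta> g"] flip: A.m_assoc)
    ultimately show ?thesis by simp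
  qed
  ultimately show ?thesis by simp
qed

text \<open>The derived subgroup lies in the kernel of \<open>loop_class\<close>, which lies in the
  kernel of \<open>\<eta>\<close>, which lies in the derived subgroup by hypothesis. Two surjections
  with equal kernels have isomorphic images.\<close>

theorem homology_quotient_iso:
  assumes "comm_group A" "\<eta> \<in> hom G A" "\<eta> ` carrier G = carrier A"
    and "kernel G A \<eta> \<subseteq> derived G (carrier G)"
  shows "homology_group 1 Y \<cong> A"
proof -
  interpret A: comm_group A by fact
  interpret \<eta>: group_hom G A \<eta> using assms(2) by unfold_locales
  have "comm_group (homology_group 1 Y)" by (rule abelian_homology_group)
  then interpret H: comm_group "homology_group 1 Y" .
  interpret \<phi>: group_hom G "homology_group 1 Y" loop_class using loop_class_hom by unfold_locales
  have "derived G (carrier G) \<subseteq> kernel G (homology_group 1 Y) loop_class"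
    unfolding derived_def
  proof (rule generate_subgroup_incl[OF _ \<phi>.subgroup_kernel])
    have "loop_class (g \<otimes> h \<otimes> inv g \<otimes> inv h) = \<one>\<^bsub>homology_group 1 Y\<^esub>" if "g \<in> carrier G" "h \<in> carrier G" for g h
    proof -
      have "loop_class g \<in> carrier (homology_group 1 Y)" "loop_class h \<in> carrier (homology_group 1 Y)"
        using that by auto
      then show ?thesis
        using that H.r_inv[of "loop_class g \<otimes>\<^bsub>homology_group 1 Y\<^esub> loop_class h"]
        by (simp add: H.inv_mult H.m_assoc)
    qed
    then show "derived_set G (carrier G) \<subseteq> kernel G (homology_group 1 Y) loop_class"
      unfolding kernel_def by auto
  qed
  moreover have "kernel G (homology_group 1 Y) loop_class \<subseteq> kernel G A \<eta>"
  proof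
    fix g assume g: "g \<in> kernel G (homology_group 1 Y) loop_class"
    then have "loop_class g = \<one>\<^bsub>homology_group (int 1) Y\<^esub>" by (simp add: kernel_def)
    then have "singular_relboundary 1 Y {} (loop g)"
      by (simp only: loop_class_def one_relative_homology_group homologous_rel_set_eq_relboundary)
    then show "g \<in> kernel G A \<eta>"
      using loop_boundary_imp_kernel[OF assms(1,2)] g by (simp add: kernel_def)
  qed
  ultimately have ker: "kernel G (homology_group 1 Y) loop_class = kernel G A \<eta>" using assms(4) by blast
  have "G Mod kernel G A \<eta> \<cong> homology_group 1 Y" "G Mod kernel G A \<eta> \<cong> A"
    using \<phi>.FactGroup_iso[OF loop_class_surj] \<eta>.FactGroup_iso[OF assms(3)] unfolding ker by blast+
  then show ?thesis
    using group.iso_sym[OF normal.factorgroup_is_group[OF \<eta>.normal_kernel]] iso_trans by blast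
qed

end

section \<open>The ring of integers\<close>

definition zw :: "int \<Rightarrow> int \<Rightarrow> int \<Rightarrow> int \<Rightarrow> real" where
  "zw a b c d = of_int a + of_int b * w\<^sub>K + of_int c * w\<^sub>K ^ 2 + of_int d * w\<^sub>K ^ 3"

definition ZW :: "real set" where "ZW = {zw a b c d |a b c d. True}"

text \<open>The norm from K to Q, in two stages. With \<open>A = a + c w^2\<close> and
  \<open>B = b + d w^2\<close>, the norm to Q(w^2) is \<open>A^2 - w^2 B^2 = P + Q w^2\<close>,
  where \<open>P\<close> and \<open>Q\<close> are the two inner expressions; its norm to Q is
  \<open>P^2 - 2 Q^2\<close>.\<close>

definition nrm :: "int \<Rightarrow> int \<Rightarrow> int \<Rightarrow> int \<Rightarrow> int" where
  "nrm a b c d = (a\<^sup>2 + 2 * c\<^sup>2 - 4 * b * d)\<^sup>2 - 2 * (2 * a * c - b\<^sup>2 - 2 * d\<^sup>2)\<^sup>2"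

lemma w4: "w\<^sub>K * (w\<^sub>K * (w\<^sub>K * w\<^sub>K)) = 2" and w4': "w\<^sub>K * (w\<^sub>K * (w\<^sub>K * (w\<^sub>K * x))) = 2 * x"
  using w\<^sub>K_power4 by (simp_all add: power4_eq_xxxx flip: mult.assoc)

lemmas w_ring_simps = algebra_simps power2_eq_square power3_eq_cube power4_eq_xxxx w4 w4'

lemma zw_in_ZW [simp]: "zw a b c d \<in> ZW"
  by (auto simp: ZW_def)

lemma ZW_cases:
  assumes "x \<in> ZW" obtains a b c d where "x = zw a b c d"
  using assms by (auto simp: ZW_def)

lemma zw_add: "zw a b c d + zw a' b' c' d' = zw (a + a') (b + b') (c + c') (d + d')"
  by (simp add: zw_def algebra_simps)

lemma zw_minus: "- zw a b c d = zw (- a) (- b) (- c) (- d)"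
  by (simp add: zw_def)

lemma zw_mult: "zw a b c d * zw a' b' c' d' =
    zw (a * a' + 2 * (b * d' + c * c' + d * b')) (a * b' + b * a' + 2 * (c * d' + d * c'))
       (a * c' + b * b' + c * a' + 2 * d * d') (a * d' + b * c' + c * b' + d * a')"
  by (simp add: zw_def w_ring_simps)

lemma of_int_mult_zw: "of_int n * zw a b c d = zw (n * a) (n * b) (n * c) (n * d)"
  by (simp add: zw_def algebra_simps)

lemma of_int_eq_zw: "of_int n = zw n 0 0 0" and w_eq_zw: "w\<^sub>K = zw 0 1 0 0"
  by (simp_all add: zw_def)

lemma ZW_add: "x \<in> ZW \<Longrightarrow> y \<in> ZW \<Longrightarrow> x + y \<in> ZW"
  and ZW_minus: "x \<in> ZW \<Longrightarrow> - x \<in> ZW"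
  and ZW_mult: "x \<in> ZW \<Longrightarrow> y \<in> ZW \<Longrightarrow> x * y \<in> ZW"
  by (auto elim!: ZW_cases simp: zw_add zw_minus zw_mult)

lemma ZW_of_int [simp]: "of_int n \<in> ZW" and ZW_w [simp]: "w\<^sub>K \<in> ZW"
  by (simp_all add: of_int_eq_zw w_eq_zw)

lemma ZW_0 [simp]: "0 \<in> ZW" and ZW_1 [simp]: "1 \<in> ZW"
  using ZW_of_int[of 0] ZW_of_int[of 1] by simp_all

lemma ZW_diff: "x \<in> ZW \<Longrightarrow> y \<in> ZW \<Longrightarrow> x - y \<in> ZW"
  using ZW_add[of x "- y"] ZW_minus by simp

lemma ZW_power: "x \<in> ZW \<Longrightarrow> x ^ n \<in> ZW"
  by (induction n) (auto simp: ZW_mult)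

lemma ZW_sum: "(\<And>i. i \<in> I \<Longrightarrow> f i \<in> ZW) \<Longrightarrow> sum f I \<in> ZW"
  by (induction I rule: infinite_finite_induct) (auto simp: ZW_add)

text \<open>\<open>2a + bw + cw\<^sup>2 + dw\<^sup>3 = w (b + cw + dw\<^sup>2 + aw\<^sup>3)\<close>, and \<open>w\<close> has norm \<open>-2\<close>.\<close>

lemma nrm_rotate: "nrm (2 * a) b c d = - 2 * nrm b c d a"
  by (simp add: nrm_def algebra_simps power2_eq_square)

text \<open>Modulo 2 the norm is \<open>a^4\<close>.\<close>

lemma nrm_eq_0_imp_even: "nrm a b c d = 0 \<Longrightarrow> even a"
proof (rule ccontr)
  assume "nrm a b c d = 0" "odd a"
  moreover have "nrm a b c d = a ^ 4 + 2 * (2 * (c\<^sup>2 - 2 * b * d)\<^sup>2 + 2 * a\<^sup>2 * (c\<^sup>2 - 2 * b * d)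
      - (2 * a * c - b\<^sup>2 - 2 * d\<^sup>2)\<^sup>2)"
    by (simp add: nrm_def algebra_simps power2_eq_square power4_eq_xxxx)
  ultimately show False by (metis dvd_0_right dvd_triv_left even_add even_power)
qed

lemma nrm_eq_0_rotate:
  assumes "nrm a b c d = 0" obtains a' where "a = 2 * a'" "nrm b c d a' = 0"
proof -
  obtain a' where "a = 2 * a'" using nrm_eq_0_imp_even[OF assms] by blast
  then show ?thesis using that assms nrm_rotate[of a' b c d] by simp
qed

lemma int_less_two_power: "n < 2 ^ nat n" for n :: int
  using of_nat_less_two_power[of "nat n", where 'a = int] by (cases "n \<ge> 0") auto

text \<open>Infinite descent: four rotations halve all four coordinates and keep the norm zero, so
  \<open>a\<close> is divisible by every power of 2.\<close>

lemma nrm_eq_0_imp_fst: "nrm a b c d = 0 \<Longrightarrow> a = 0"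
proof -
  have "\<forall>a b c d. nrm a b c d = 0 \<longrightarrow> 2 ^ n dvd a" for n
  proof (induction n)
    case (Suc n)
    show ?case
    proof (intro allI impI)
      fix a b c d assume "nrm a b c d = 0"
      then obtain a' where a: "a = 2 * a'" "nrm b c d a' = 0" by (rule nrm_eq_0_rotate)
      from a(2) obtain b' where "nrm c d a' b' = 0" by (rule nrm_eq_0_rotate)
      then obtain c' where "nrm d a' b' c' = 0" by (rule nrm_eq_0_rotate)
      then obtain d' where "nrm a' b' c' d' = 0" by (rule nrm_eq_0_rotate)
      then have "2 ^ n dvd a'" using Suc by blast
      then show "2 ^ Suc n dvd a" by (simp add: a)
    qed
  qed simp
  moreover assume "nrm a b c d = 0"
  ultimately have "2 ^ nat \<bar>a\<bar> dvd a" by blast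
  moreover have "\<bar>a\<bar> < 2 ^ nat \<bar>a\<bar>" by (rule int_less_two_power)
  ultimately show "a = 0" using zdvd_not_zless[of "\<bar>a\<bar>" "2 ^ nat \<bar>a\<bar>"] by auto
qed

lemma nrm_eq_0_iff: "nrm a b c d = 0 \<longleftrightarrow> a = 0 \<and> b = 0 \<and> c = 0 \<and> d = 0"
proof
  assume *: "nrm a b c d = 0"
  then have a: "a = 0" by (rule nrm_eq_0_imp_fst)
  with * have "nrm b c d 0 = 0" using nrm_rotate[of 0 b c d] by simp
  moreover from this have b: "b = 0" by (rule nrm_eq_0_imp_fst)
  ultimately have "nrm c d 0 0 = 0" using nrm_rotate[of 0 c d 0] by simp
  moreover from this have c: "c = 0" by (rule nrm_eq_0_imp_fst)
  ultimately have "nrm d 0 0 0 = 0" using nrm_rotate[of 0 d 0 0] by simp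
  then have "d = 0" by (rule nrm_eq_0_imp_fst)
  with a b c show "a = 0 \<and> b = 0 \<and> c = 0 \<and> d = 0" by blast
qed (simp add: nrm_def)

text \<open>The second factor is the conjugate under \<open>w -> -w\<close>. It turns the first into
  an element of Z[w^2], and the third factor is the conjugate of that element under
  \<open>w^2 -> -w^2\<close>.\<close>

lemma zw_mult_conjugate:
  "zw a b c d * (zw a (- b) c (- d) * zw (a\<^sup>2 + 2 * c\<^sup>2 - 4 * b * d) 0 (b\<^sup>2 + 2 * d\<^sup>2 - 2 * a * c) 0) = of_int (nrm a b c d)"
  by (simp add: zw_def nrm_def w_ring_simps)

text \<open>Linear independence of the powers of w, from the fact that the norm vanishes only at
  zero.\<close>

lemma zw_eq_0_iff: "zw a b c d = 0 \<longleftrightarrow> a = 0 \<and> b = 0 \<and> c = 0 \<and> d = 0"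
proof
  assume "zw a b c d = 0"
  then have "real_of_int (nrm a b c d) = 0" using zw_mult_conjugate[of a b c d] by simp
  then show "a = 0 \<and> b = 0 \<and> c = 0 \<and> d = 0" using nrm_eq_0_iff by simp
qed (simp add: zw_def)

lemma zw_eq_iff: "zw a b c d = zw a' b' c' d' \<longleftrightarrow> a = a' \<and> b = b' \<and> c = c' \<and> d = d'"
proof -
  have "zw a b c d = zw a' b' c' d' \<longleftrightarrow> zw (a - a') (b - b') (c - c') (d - d') = 0"
    by (simp add: zw_def algebra_simps)
  then show ?thesis by (simp add: zw_eq_0_iff)
qed

section \<open>Fractions and integrality of Z[w]\<close>

text \<open>Having a denominator is preserved by all field operations; for inverses the norm of the
  numerator serves as denominator.\<close>

lemma carrier_K_imp_fraction:
  assumes "x \<in> carrier K" obtains D :: int where "D > 0" "of_int D * x \<in> ZW"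
proof -
  interpret F: field "type_field :: real ring" by (rule field_type_field)
  have tf [simp]: "carrier (type_field :: real ring) = UNIV" "\<one>\<^bsub>type_field\<^esub> = (1::real)" "\<zero>\<^bsub>type_field\<^esub> = (0::real)"
    "x \<oplus>\<^bsub>type_field\<^esub> y = x + y" "x \<otimes>\<^bsub>type_field\<^esub> y = x * y" for x y :: real
    by (simp_all add: type_field_def)
  have "x \<in> generate_field type_field {w\<^sub>K}" using assms by (simp add: K_def)
  then have "\<exists>D::int. D > 0 \<and> of_int D * x \<in> ZW"
  proof (induction rule: generate_field.induct)
    case one
    then show ?case by (intro exI[of _ 1]) simp
  next
    case (incl h)
    then show ?case by (intro exI[of _ 1]) simp
  next
    case (a_inv h)
    then obtain D :: int where D: "D > 0" "of_int D * h \<in> ZW" by blast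
    have "\<ominus>\<^bsub>type_field\<^esub> h = - h" by (rule F.minus_equality) auto
    then show ?case using D ZW_minus[OF D(2)] by (intro exI[of _ D]) simp
  next
    case (m_inv h)
    then obtain D :: int where D: "D > 0" "of_int D * h \<in> ZW" by blast
    have h: "h \<noteq> 0" using m_inv by simp
    have inv: "inv\<^bsub>type_field\<^esub> h = inverse h" using h by (intro F.comm_inv_char) auto
    obtain a b c d where z: "of_int D * h = zw a b c d" using D(2) by (rule ZW_cases)
    then have "zw a b c d \<noteq> 0" using D(1) h by auto
    then have n: "nrm a b c d \<noteq> 0" by (simp add: nrm_eq_0_iff zw_eq_0_iff)
    obtain y where y: "y \<in> ZW" "zw a b c d * y = of_int (nrm a b c d)"
      using zw_mult_conjugate ZW_mult zw_in_ZW by metis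
    have "of_int (nrm a b c d) * inverse h = of_int D * y"
      using y(2) h by (simp add: field_simps flip: z)
    then have "of_int \<bar>nrm a b c d\<bar> * inverse h \<in> ZW"
      using ZW_mult[OF ZW_of_int y(1), of D] ZW_minus by (cases "nrm a b c d \<ge> 0") (auto simp: mult.assoc)
    then show ?case using n inv by (intro exI[of _ "\<bar>nrm a b c d\<bar>"]) simp
  next
    case (eng_add h1 h2)
    then obtain D E :: int where D: "D > 0" "of_int D * h1 \<in> ZW" and E: "E > 0" "of_int E * h2 \<in> ZW" by blast
    have "of_int (D * E) * (h1 + h2) = of_int E * (of_int D * h1) + of_int D * (of_int E * h2)"
      by (simp add: algebra_simps)
    then show ?case using D E by (intro exI[of _ "D * E"]) (auto intro!: ZW_add ZW_mult)
  next
    case (eng_mult h1 h2)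
    then obtain D E :: int where D: "D > 0" "of_int D * h1 \<in> ZW" and E: "E > 0" "of_int E * h2 \<in> ZW" by blast
    have "of_int (D * E) * (h1 * h2) = (of_int D * h1) * (of_int E * h2)"
      by (simp add: algebra_simps)
    then show ?case using D E ZW_mult[OF D(2) E(2)] by (intro exI[of _ "D * E"]) (simp add: mult_ac)
  qed
  then show ?thesis using that by blast
qed

lemma ZW_imp_algebraic_int:
  assumes "x \<in> ZW" shows "algebraic_int x"
proof -
  obtain a b c d where x: "x = zw a b c d" using assms by (rule ZW_cases)
  define P Q where "P = a\<^sup>2 + 2 * c\<^sup>2 - 4 * b * d" and "Q = 2 * a * c - b\<^sup>2 - 2 * d\<^sup>2"
  \<comment> \<open>The characteristic polynomial of multiplication by \<open>x\<close>, obtained as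
    \<open>nrm (T - a) (- b) (- c) (- d)\<close>, that is
    \<open>(T^2 - 2 a T + P)^2 - 2 (Q - 2 c T)^2\<close>.\<close>
  let ?p = "[:P\<^sup>2 - 2 * Q\<^sup>2, - 4 * a * P + 8 * c * Q, 4 * a\<^sup>2 + 2 * P - 8 * c\<^sup>2, - 4 * a, 1:]"
  have "poly (map_poly of_int ?p) x = 0"
    by (simp add: map_poly_pCons x zw_def P_def Q_def w_ring_simps)
  then show ?thesis
    unfolding algebraic_int_altdef_ipoly by (intro exI[of _ ?p]) simp
qed

lemma ZW_subset_K: "ZW \<subseteq> carrier K"
proof -
  have n: "of_nat n \<in> carrier K" for n
  proof (induction n)
    case 0
    show ?case using carrier_K_intros(3)[OF carrier_K_intros(2) carrier_K_intros(5)[OF carrier_K_intros(2)]] by simp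
  qed (use carrier_K_intros in auto)
  have "of_int i \<in> carrier K" for i
    using n carrier_K_intros(5) by (cases i rule: int_cases2) auto
  then have "zw a b c d \<in> carrier K" for a b c d
    unfolding zw_def power2_eq_square power3_eq_cube by (intro carrier_K_intros)
  then show ?thesis by (auto simp: ZW_def)
qed

section \<open>Integral closedness of Z[w]\<close>

text \<open>A substitute for integrality that is visibly stable under multiplication by \<open>Z[w]\<close>, so that closure
  of the algebraic integers under sums and products is not needed.\<close>

definition almost_integral :: "real \<Rightarrow> bool" where
  "almost_integral x \<longleftrightarrow> (\<exists>N::int. N > 0 \<and> (\<forall>k. of_int N * x ^ k \<in> ZW))"

lemma almost_integral_mult:
  assumes "z \<in> ZW" "almost_integral x" shows "almost_integral (z * x)"
proof -
  obtain N :: int where N: "N > 0" "\<And>k. of_int N * x ^ k \<in> ZW" using assms(2) by (auto simp: almost_integral_def)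
  have "of_int N * (z * x) ^ k = z ^ k * (of_int N * x ^ k)" for k by (simp add: power_mult_distrib)
  then have "of_int N * (z * x) ^ k \<in> ZW" for k
    using ZW_mult[OF ZW_power[OF assms(1)] N(2)] by metis
  then show ?thesis
    unfolding almost_integral_def using N(1) by blast
qed

text \<open>A common denominator of the powers below the degree of a monic equation works for all
  powers, since the equation expresses higher powers through lower ones.\<close>

lemma algebraic_int_imp_almost_integral:
  assumes "x \<in> carrier K" "algebraic_int x" shows "almost_integral x"
proof -
  obtain p where p: "poly (map_poly of_int p) x = 0" "lead_coeff p = 1"
    using assms(2) unfolding algebraic_int_altdef_ipoly by blast
  define n where "n = degree p"
  have "x ^ k \<in> carrier K" for k
    by (induction k) (use carrier_K_intros assms(1) in auto)
  then have "\<forall>k. \<exists>D::int. D > 0 \<and> of_int D * x ^ k \<in> ZW"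
    using carrier_K_imp_fraction by metis
  then obtain D :: "nat \<Rightarrow> int" where D: "\<And>k. D k > 0" "\<And>k. of_int (D k) * x ^ k \<in> ZW" by metis
  define N where "N = (\<Prod>k<n. D k)"
  have "of_int N * x ^ k \<in> ZW" for k
  proof (induction k rule: less_induct)
    case (less k)
    show ?case
    proof (cases "k < n")
      case True
      then have "N = (\<Prod>i\<in>{..<n} - {k}. D i) * D k" unfolding N_def by (subst prod.remove[of _ k]) auto
      then have "of_int N * x ^ k = of_int (\<Prod>i\<in>{..<n} - {k}. D i) * (of_int (D k) * x ^ k)" by simp
      then show ?thesis using ZW_mult[OF ZW_of_int D(2)] by metis
    next
      case False
      have "(\<Sum>i\<le>n. of_int (coeff p i) * x ^ i) = 0"
        using p(1) by (simp add: poly_altdef n_def degree_map_poly coeff_map_poly)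
      then have "(\<Sum>i<n. of_int (coeff p i) * x ^ i) + x ^ n = 0"
        using p(2) by (simp add: n_def lessThan_Suc_atMost[symmetric])
      then have xn: "x ^ n = - (\<Sum>i<n. of_int (coeff p i) * x ^ i)" by simp
      have "of_int N * x ^ k = x ^ n * (of_int N * x ^ (k - n))" using False by (simp add: power_add[symmetric])
      also have "\<dots> = - (\<Sum>i<n. of_int (coeff p i) * (of_int N * x ^ (i + (k - n))))"
        unfolding xn by (simp add: sum_distrib_right sum_distrib_left power_add mult_ac)
      also have "\<dots> \<in> ZW"
        using False by (intro ZW_minus ZW_sum ZW_mult[OF ZW_of_int] less) auto
      finally show ?thesis .
    qed
  qed
  moreover have "N > 0" unfolding N_def using D(1) by (intro prod_pos) auto
  ultimately show ?thesis unfolding almost_integral_def by blast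
qed

lemma of_int_mult_ZW_iff: "zw a b c d \<in> (*) (of_int n) ` ZW \<longleftrightarrow> n dvd a \<and> n dvd b \<and> n dvd c \<and> n dvd d"
proof
  assume "zw a b c d \<in> (*) (of_int n) ` ZW"
  then obtain a' b' c' d' where "zw a b c d = of_int n * zw a' b' c' d'" by (metis ZW_cases image_iff)
  then show "n dvd a \<and> n dvd b \<and> n dvd c \<and> n dvd d" by (simp add: of_int_mult_zw zw_eq_iff)
next
  assume "n dvd a \<and> n dvd b \<and> n dvd c \<and> n dvd d"
  then obtain a' b' c' d' where "a = n * a'" "b = n * b'" "c = n * c'" "d = n * d'" unfolding dvd_def by blast
  then have "zw a b c d = of_int n * zw a' b' c' d'" by (simp add: of_int_mult_zw)
  then show "zw a b c d \<in> (*) (of_int n) ` ZW" by (rule image_eqI) simp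
qed

text \<open>\<open>Z[w]/p\<close> is reduced for odd \<open>p\<close>. With \<open>A = a + c w\<^sup>2\<close> and \<open>B = b + d w\<^sup>2\<close> the hypothesis says that
  \<open>A\<^sup>2 + B\<^sup>2 w\<^sup>2\<close> and \<open>A B\<close> vanish modulo \<open>p\<close>, hence so does \<open>A\<^sup>3 = A (A\<^sup>2 + B\<^sup>2 w\<^sup>2) - B (A B) w\<^sup>2\<close>.\<close>

lemma square_dvd_imp_dvd:
  assumes p: "prime (p :: int)" "odd p"
    and s: "p dvd a * a + 2 * (b * d + c * c + d * b)" "p dvd a * b + b * a + 2 * (c * d + d * c)"
      "p dvd a * c + b * b + c * a + 2 * d * d" "p dvd a * d + b * c + c * b + d * a"
  shows "p dvd a \<and> p dvd b \<and> p dvd c \<and> p dvd d"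
proof -
  have two: "p dvd x" if "p dvd 2 * x" for x
  proof -
    have "\<not> p dvd 2"
      using p prime_gt_1_int[OF p(1)] zdvd_imp_le[of p 2] by (metis order_antisym_conv dvd_refl int_one_le_iff_zero_less zless_imp_add1_zle one_add_one zero_less_numeral)
    then show ?thesis using that p(1) prime_dvd_mult_iff by blast
  qed
  have cube: "p dvd x" if "p dvd x * x * x" for x
    using that p(1) by (simp add: prime_dvd_mult_iff)
  have s2: "p dvd a * b + 2 * c * d" by (rule two) (use s(2) in \<open>simp add: algebra_simps\<close>)
  have s4: "p dvd a * d + b * c" by (rule two) (use s(4) in \<open>simp add: algebra_simps\<close>)
  define s1 s2 s3 s4 where s_defs: "s1 = a * a + 2 * (b * d + c * c + d * b)" "s2 = a * b + 2 * c * d"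
    "s3 = a * c + b * b + c * a + 2 * d * d" "s4 = a * d + b * c"
  \<comment> \<open>In the notation above, \<open>A^3 = x + y w^2\<close> and
    \<open>A^2 = e + f w^2\<close>. The vanishing of \<open>A^3\<close> modulo \<open>p\<close> is
    passed down to \<open>e\<close> and \<open>f\<close>, then to \<open>a\<close> and
    \<open>c\<close>, by cubes and squares.\<close>
  define x y where xy_defs: "x = a * a * a + 6 * a * c * c" "y = 3 * a * a * c + 2 * c * c * c"
  define e f where ef_defs: "e = a * a + 2 * c * c" "f = 2 * a * c"
  note defs = s_defs xy_defs ef_defs
  note dvds = dvd_add dvd_diff dvd_mult
  have s: "p dvd s1" "p dvd s2" "p dvd s3" "p dvd s4" using s(1,3) s2 s4 by (simp_all only: s_defs)
  have "x = a * s1 + 2 * c * s3 - 2 * b * s4 - 2 * d * s2" by (simp add: defs algebra_simps)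
  then have x: "p dvd x" by (simp add: s)
  have "y = a * s3 + c * s1 - b * s2 - 2 * d * s4" by (simp add: defs algebra_simps)
  then have y: "p dvd y" by (simp add: s)
  have "e * e * e = e * (a * x + 2 * c * y) - f * (a * y + c * x)" by (simp add: defs algebra_simps)
  then have e: "p dvd e" by - (rule cube, simp add: x y)
  have "2 * (f * f) = a * x + 2 * c * y - e * e" by (simp add: defs algebra_simps)
  then have "p dvd f * f" by - (rule two, simp add: x y e)
  then have f: "p dvd f" using p(1) prime_dvd_mult_iff by blast
  have "a * a * a = a * e - c * f" by (simp add: defs algebra_simps)
  then have a: "p dvd a" by - (rule cube, simp add: e f)
  have "2 * (c * c) = e - a * a" by (simp add: defs)
  then have "p dvd c * c" by - (rule two, simp add: e a)
  then have c: "p dvd c" using p(1) prime_dvd_mult_iff by blast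
  \<comment> \<open>With \<open>a\<close> and \<open>c\<close> gone, the first and third conditions
    say that \<open>B^2 = (b^2 + 2 d^2) + 2 b d w^2\<close> vanishes modulo
    \<open>p\<close>.\<close>
  have "2 * (2 * (b * d)) = s1 - a * a - 2 * c * c" by (simp add: defs algebra_simps)
  then have "p dvd 2 * (2 * (b * d))" by (simp only:) (simp add: s a c)
  then have bd: "p dvd b * d" by (rule two[OF two])
  have "b * b * b = b * (s3 - f) - 2 * d * (b * d)" by (simp add: defs algebra_simps)
  then have b: "p dvd b" by - (rule cube, simp add: s f bd)
  have "2 * (d * d) = s3 - f - b * b" by (simp add: defs algebra_simps)
  then have "p dvd d * d" by - (rule two, simp add: s f b)
  then have "p dvd d" using p(1) prime_dvd_mult_iff by blast
  with a b c show ?thesis by blast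
qed

text \<open>Reducedness modulo \<open>p\<close>, applied to one squaring at a time.\<close>

lemma power_dvd_imp_dvd:
  assumes "prime (p :: int)" "odd p" "y \<in> ZW" "y ^ (2 ^ j) \<in> (*) (of_int p) ` ZW"
  shows "y \<in> (*) (of_int p) ` ZW"
  using assms(3,4)
proof (induction j arbitrary: y)
  case (Suc j)
  have "(y\<^sup>2) ^ (2 ^ j) \<in> (*) (of_int p) ` ZW" using Suc.prems(2) by (simp flip: power_mult)
  then have *: "y\<^sup>2 \<in> (*) (of_int p) ` ZW" using Suc.IH ZW_power Suc.prems(1) by blast
  obtain a b c d where y: "y = zw a b c d" using Suc.prems(1) by (rule ZW_cases)
  show ?case
    using * square_dvd_imp_dvd[OF assms(1,2)] unfolding y power2_eq_square zw_mult of_int_mult_ZW_iff by blast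
qed simp

text \<open>With \<open>y = p x\<close>, the number \<open>N y^k\<close> is divisible by
  \<open>p^k\<close>. Once \<open>p^k > N\<close>, the factor \<open>N\<close> cannot absorb all of
  it, so \<open>p\<close> divides \<open>y^k\<close> and then \<open>y\<close>.\<close>

lemma almost_integral_odd_prime:
  assumes p: "prime (p :: int)" "odd p" and x: "almost_integral x" "of_int p * x \<in> ZW"
  shows "x \<in> ZW"
proof -
  obtain N :: int where N: "N > 0" "\<And>k. of_int N * x ^ k \<in> ZW" using x(1) by (auto simp: almost_integral_def)
  define y where "y = of_int p * x"
  \<comment> \<open>A power of two, as \<open>power_dvd_imp_dvd\<close> asks, and at least
    \<open>N\<close>, so that \<open>p^k > N\<close>.\<close>
  define k where "k = (2::nat) ^ nat N"
  have "p > 1" using p(1) prime_gt_1_int by blast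
  have "N < p ^ k"
  proof -
    have "nat N \<le> k" unfolding k_def by (rule less_imp_le[OF less_exp])
    then have "N < 2 ^ k" using int_less_two_power[of N] power_increasing[of "nat N" k "2::int"] by linarith
    also have "2 ^ k \<le> p ^ k" using \<open>p > 1\<close> by (intro power_mono) auto
    finally show ?thesis .
  qed
  have *: "p dvd e" if "p ^ k dvd N * e" for e
  proof (rule ccontr)
    assume "\<not> p dvd e"
    then have "coprime (p ^ k) e" using p(1) prime_imp_coprime by auto
    then have "p ^ k dvd N" using that coprime_dvd_mult_left_iff by blast
    then show False using zdvd_imp_le N(1) \<open>N < p ^ k\<close> by fastforce
  qed
  have "y ^ k \<in> ZW" using x(2) ZW_power by (simp add: y_def)
  then obtain a b c d where yk: "y ^ k = zw a b c d" by (rule ZW_cases)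
  have "of_int N * y ^ k = of_int (p ^ k) * (of_int N * x ^ k)" by (simp add: y_def power_mult_distrib)
  then have "of_int N * y ^ k \<in> (*) (of_int (p ^ k)) ` ZW" using N(2) by blast
  then have "y ^ k \<in> (*) (of_int p) ` ZW"
    unfolding yk of_int_mult_zw of_int_mult_ZW_iff using * by blast
  then have "y \<in> (*) (of_int p) ` ZW"
    using power_dvd_imp_dvd[OF p] x(2) unfolding k_def y_def by blast
  then show ?thesis using \<open>p > 1\<close> by (auto simp: y_def)
qed

text \<open>The parity of the constant coordinate is the residue modulo w. If it were odd for
  \<open>w x\<close>, it would be odd for all powers, although \<open>N\<close> times the power
  \<open>4 k\<close> is divisible by \<open>2^k > N\<close>.\<close>

lemma almost_integral_w:
  assumes x: "almost_integral x" "w\<^sub>K * x \<in> ZW"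
  shows "x \<in> ZW"
proof -
  obtain N :: int where N: "N > 0" "\<And>k. of_int N * x ^ k \<in> ZW" using x(1) by (auto simp: almost_integral_def)
  obtain a b c d where y: "w\<^sub>K * x = zw a b c d" using x(2) by (rule ZW_cases)
  have pow: "\<exists>a' b' c' d'. zw a b c d ^ m = zw a' b' c' d' \<and> (odd a \<longrightarrow> odd a')" for m
  proof (induction m)
    case 0
    have "zw a b c d ^ 0 = zw 1 0 0 0" by (simp add: zw_def)
    then show ?case by (metis odd_one)
  next
    case (Suc m)
    then obtain a' b' c' d' where "zw a b c d ^ m = zw a' b' c' d'" "odd a \<longrightarrow> odd a'" by blast
    then have "zw a b c d ^ Suc m = zw a b c d * zw a' b' c' d'" "odd a \<longrightarrow> odd (a * a' + 2 * (b * d' + c * c' + d * b'))"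
      by simp_all
    then show ?case unfolding zw_mult by blast
  qed
  have "even a"
  proof (rule ccontr)
    assume "odd a"
    define k where "k = nat N"
    obtain a' b' c' d' where yk: "zw a b c d ^ (4 * k) = zw a' b' c' d'" "odd a'" using pow \<open>odd a\<close> by blast
    have "of_int N * (w\<^sub>K * x) ^ (4 * k) = of_int (2 ^ k) * (of_int N * x ^ (4 * k))"
      by (simp add: power_mult_distrib power_mult w\<^sub>K_power4)
    then have "of_int N * zw a b c d ^ (4 * k) \<in> (*) (of_int (2 ^ k)) ` ZW" using N(2) unfolding y by blast
    then have "2 ^ k dvd N * a'" unfolding yk of_int_mult_zw of_int_mult_ZW_iff by blast
    then have "2 ^ k dvd N" using yk(2) by (simp add: coprime_dvd_mult_left_iff)
    then have "2 ^ k \<le> N" using zdvd_imp_le N(1) by blast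
    moreover have "N < 2 ^ k" unfolding k_def by (rule int_less_two_power)
    ultimately show False by simp
  qed
  then obtain a' where "a = 2 * a'" by blast
  then have "w\<^sub>K * x = w\<^sub>K * zw b c d a'" by (simp add: y zw_def w_ring_simps)
  moreover have "w\<^sub>K \<noteq> 0" using w\<^sub>K_power4 by auto
  ultimately show ?thesis by simp
qed

text \<open>The prime factors of the denominator are removed one by one; the prime 2 equals
  \<open>w^4\<close> and is removed in four steps of w.\<close>

lemma almost_integral_imp_ZW:
  assumes "almost_integral x" "D > 0" "of_nat D * x \<in> ZW" shows "x \<in> ZW"
  using assms
proof (induction D arbitrary: x rule: less_induct)
  case (less D)
  show ?case
  proof (cases "D = 1")
    case True
    then show ?thesis using less by simp
  next
    case False
    then obtain p where p: "prime p" "p dvd D" using prime_factor_nat by blast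
    then obtain E where E: "D = p * E" by blast
    have "E < D" "E > 0" using E less.prems(2) prime_gt_1_nat[OF p(1)] by auto
    define x' where "x' = of_nat E * x"
    have x': "almost_integral x'" "of_nat p * x' \<in> ZW"
      using almost_integral_mult[OF ZW_of_int[of "int E"] less.prems(1)] less.prems(3) by (simp_all add: x'_def E mult.assoc)
    have "x' \<in> ZW"
    proof (cases "p = 2")
      case True
      have ai: "almost_integral (w\<^sub>K ^ k * x')" for k using almost_integral_mult x'(1) ZW_power ZW_w by blast
      have "w\<^sub>K ^ k * x' \<in> ZW \<Longrightarrow> x' \<in> ZW" for k
      proof (induction k)
        case (Suc k)
        then show ?case using almost_integral_w[OF ai[of k]] by (simp add: mult.assoc)
      qed simp
      then show ?thesis using x'(2) True w\<^sub>K_power4 by (metis of_nat_numeral)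
    next
      case False
      then have "odd (int p)" "prime (int p)" using p(1) prime_odd_nat prime_gt_1_nat[OF p(1)] by (auto simp: prime_nat_iff' intro: ccontr)
      then show ?thesis using almost_integral_odd_prime[of "int p"] x' by simp
    qed
    then show ?thesis using less.IH[OF \<open>E < D\<close> less.prems(1) \<open>E > 0\<close>] by (simp add: x'_def)
  qed
qed

theorem carrier_O\<^sub>K: "carrier O\<^sub>K = ZW"
proof
  show "carrier O\<^sub>K \<subseteq> ZW"
  proof
    fix x assume "x \<in> carrier O\<^sub>K"
    then have x: "x \<in> carrier K" "algebraic_int x" by (auto simp: O\<^sub>K_def)
    obtain D :: int where D: "D > 0" "of_int D * x \<in> ZW" using carrier_K_imp_fraction[OF x(1)] .
    then show "x \<in> ZW"
      using almost_integral_imp_ZW[OF algebraic_int_imp_almost_integral[OF x], of "nat D"] by simp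
  qed
  show "ZW \<subseteq> carrier O\<^sub>K" using ZW_subset_K ZW_imp_algebraic_int by (auto simp: O\<^sub>K_def)
qed

section \<open>Units and embeddings\<close>

lemma w_bounds: "1 < w\<^sub>K" "w\<^sub>K\<^sup>2 < 3 / 2" "w\<^sub>K < 3"
proof -
  have pos: "w\<^sub>K \<ge> 0" by (simp add: w\<^sub>K_def)
  show 1: "1 < w\<^sub>K"
  proof (rule ccontr)
    assume "\<not> 1 < w\<^sub>K"
    then have "w\<^sub>K ^ 4 \<le> 1 ^ 4" using pos by (intro power_mono) auto
    then show False using w\<^sub>K_power4 by simp
  qed
  show 2: "w\<^sub>K\<^sup>2 < 3 / 2"
  proof (rule ccontr)
    assume "\<not> w\<^sub>K\<^sup>2 < 3 / 2"
    then have "(3 / 2)\<^sup>2 \<le> (w\<^sub>K\<^sup>2)\<^sup>2" by (intro power_mono) auto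
    then show False using w\<^sub>K_power4 by (simp add: power2_eq_square power4_eq_xxxx mult.assoc)
  qed
  have "w\<^sub>K * 1 \<le> w\<^sub>K * w\<^sub>K" using 1 by (intro mult_left_mono) auto
  then show "w\<^sub>K < 3" using 2 by (simp add: power2_eq_square)
qed

text \<open>A positive exponent gives a power of at least \<open>c\<close>, a negative one a power
  of at most \<open>inverse c\<close>.\<close>

lemma power_int_near_1_imp_0:
  fixes r :: real
  assumes "1 \<le> c" "c \<le> r" "inverse c < r powi b" "r powi b < c" shows "b = 0"
proof (rule ccontr)
  assume "b \<noteq> 0"
  have ge: "c \<le> r powi n" if "n > 0" for n
  proof -
    have "r ^ 1 \<le> r ^ nat n" using assms that by (intro power_increasing) auto
    then show ?thesis using that assms by (simp add: power_int_def)
  qed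
  have "b < 0" using ge[of b] assms(4) \<open>b \<noteq> 0\<close> by (cases "b > 0") auto
  then have "c \<le> inverse (r powi b)" using ge[of "- b"] by (simp add: power_int_minus)
  then have "r powi b \<le> inverse c"
    using assms by (metis inverse_inverse_eq le_imp_inverse_le less_le_trans zero_less_one)
  then show False using assms(3) by simp
qed

section \<open>Field embeddings\<close>

lemma field_embedding_hom:
  assumes "\<sigma> \<in> field_embeddings"
  shows "\<lbrakk>x \<in> carrier K; y \<in> carrier K\<rbrakk> \<Longrightarrow> \<sigma> (x + y) = \<sigma> x + \<sigma> y"
    and "\<lbrakk>x \<in> carrier K; y \<in> carrier K\<rbrakk> \<Longrightarrow> \<sigma> (x * y) = \<sigma> x * \<sigma> y"
    and "\<sigma> 1 = 1"
proof -
  have K: "(\<oplus>\<^bsub>K\<^esub>) = (+)" "(\<otimes>\<^bsub>K\<^esub>) = (*)" "\<one>\<^bsub>K\<^esub> = 1"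
    and F: "(\<oplus>\<^bsub>type_field\<^esub>) = (+)" "(\<otimes>\<^bsub>type_field\<^esub>) = (*)" "\<one>\<^bsub>type_field\<^esub> = 1"
    by (simp_all add: K_def type_field_def)
  have h: "\<sigma> \<in> ring_hom K type_field" using assms by (simp add: field_embeddings_def)
  show "\<lbrakk>x \<in> carrier K; y \<in> carrier K\<rbrakk> \<Longrightarrow> \<sigma> (x + y) = \<sigma> x + \<sigma> y"
    using ring_hom_add[OF h, of x y] unfolding K F .
  show "\<lbrakk>x \<in> carrier K; y \<in> carrier K\<rbrakk> \<Longrightarrow> \<sigma> (x * y) = \<sigma> x * \<sigma> y"
    using ring_hom_mult[OF h, of x y] unfolding K F .
  show "\<sigma> 1 = 1" using ring_hom_one[OF h] unfolding K F .
qed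

locale embedding =
  fixes \<sigma> :: "real \<Rightarrow> 'a::field_char_0"
  assumes embedding: "\<sigma> \<in> field_embeddings"
begin

lemma ZW_K: "x \<in> ZW \<Longrightarrow> x \<in> carrier K" using ZW_subset_K by blast

lemmas hom_add_K = field_embedding_hom(1)[OF embedding]
  and hom_mult_K = field_embedding_hom(2)[OF embedding]

lemmas hom_add = hom_add_K[OF ZW_K ZW_K]
  and hom_mult = hom_mult_K[OF ZW_K ZW_K]
  and hom_1 = field_embedding_hom(3)[OF embedding]

lemma hom_0: "\<sigma> 0 = 0" using hom_add[of 0 0] by simp

lemma hom_minus: "x \<in> ZW \<Longrightarrow> \<sigma> (- x) = - \<sigma> x"
  using hom_add[OF _ ZW_minus, of x x] by (simp add: hom_0 eq_neg_iff_add_eq_0 add.commute)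

lemma hom_of_int: "\<sigma> (of_int n) = of_int n"
proof -
  have n: "\<sigma> (of_nat k) = of_nat k" for k
  proof (induction k)
    case (Suc k)
    then show ?case using hom_add[of 1 "of_nat k"] ZW_of_int[of "int k"] by (simp add: hom_1)
  qed (simp add: hom_0)
  show ?thesis
  proof (cases n rule: int_cases2)
    case (nonneg k)
    then show ?thesis using n by simp
  next
    case (nonpos k)
    then show ?thesis using n hom_minus[OF ZW_of_int[of "int k"]] by simp
  qed
qed

lemma hom_power: "x \<in> ZW \<Longrightarrow> \<sigma> (x ^ n) = \<sigma> x ^ n"
  by (induction n) (simp_all add: hom_1 hom_mult ZW_power)

lemma hom_power_int:
  assumes "x \<in> ZW" "inverse x \<in> ZW" "x \<noteq> 0"
  shows "\<sigma> (x powi n) = \<sigma> x powi n"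
proof -
  have "\<sigma> x * \<sigma> (inverse x) = 1" using hom_mult[OF assms(1,2)] assms(3) by (simp add: hom_1)
  then have "\<sigma> (inverse x) = inverse (\<sigma> x)" by (simp add: inverse_unique)
  then show ?thesis using assms by (simp add: power_int_def hom_power)
qed

lemma hom_zw: "\<sigma> (zw a b c d) = of_int a + of_int b * \<sigma> w\<^sub>K + of_int c * \<sigma> w\<^sub>K ^ 2 + of_int d * \<sigma> w\<^sub>K ^ 3"
  unfolding zw_def by (simp add: hom_add hom_mult hom_of_int hom_power ZW_add ZW_mult ZW_power)

lemma hom_w_power4: "\<sigma> w\<^sub>K ^ 4 = 2"
  using hom_power[OF ZW_w, of 4] hom_of_int[of 2] by (simp add: w\<^sub>K_power4)

end

text \<open>The image of w is a fourth root of 2. A real image would make all of K real, by writing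
  its elements as fractions over Z[w]; factoring \<open>t^4 - w^4\<close> leaves the two imaginary
  roots.\<close>

lemma imaginary_embedding_w:
  assumes "\<sigma> \<in> field_embeddings" "\<not> \<sigma> ` carrier K \<subseteq> \<real>"
  shows "Re (\<sigma> w\<^sub>K) = 0" "\<bar>Im (\<sigma> w\<^sub>K)\<bar> = w\<^sub>K"
proof -
  interpret embedding \<sigma> using assms(1) by unfold_locales
  let ?s = "\<sigma> w\<^sub>K"
  have "?s \<notin> \<real>"
  proof
    assume s: "?s \<in> \<real>"
    have "\<sigma> x \<in> \<real>" if x: "x \<in> carrier K" for x
    proof -
      obtain D :: int where D: "D > 0" "of_int D * x \<in> ZW" using carrier_K_imp_fraction[OF x] .
      obtain a b c d where "of_int D * x = zw a b c d" using D(2) by (rule ZW_cases)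
      then have "of_int D * \<sigma> x = \<sigma> (zw a b c d)"
        using hom_mult_K[OF ZW_K[OF ZW_of_int] x] by (metis hom_of_int)
      also have "\<dots> \<in> \<real>" unfolding hom_zw using s by (intro Reals_add Reals_mult Reals_power) auto
      finally have "of_int D * \<sigma> x / of_int D \<in> \<real>" by (intro Reals_divide) auto
      then show ?thesis using D(1) by simp
    qed
    then show False using assms(2) by blast
  qed
  have "(?s - of_real w\<^sub>K) * (?s + of_real w\<^sub>K) * ((?s - \<i> * of_real w\<^sub>K) * (?s + \<i> * of_real w\<^sub>K)) = ?s ^ 4 - of_real (w\<^sub>K ^ 4)"
    by (simp add: algebra_simps power4_eq_xxxx)
  also have "\<dots> = 0" using hom_w_power4 w\<^sub>K_power4 by simp
  finally have "?s = of_real w\<^sub>K \<or> ?s = - of_real w\<^sub>K \<or> ?s = \<i> * of_real w\<^sub>K \<or> ?s = - (\<i> * of_real w\<^sub>K)"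
    by (auto simp: eq_neg_iff_add_eq_0)
  then have "?s = \<i> * of_real w\<^sub>K \<or> ?s = - (\<i> * of_real w\<^sub>K)"
    using \<open>?s \<notin> \<real>\<close> by auto
  then show "Re ?s = 0" "\<bar>Im ?s\<bar> = w\<^sub>K" using w_bounds(1) by auto
qed

section \<open>The unit group and the semidirect product\<close>

lemma monoid_O\<^sub>K: "comm_monoid O\<^sub>K"
  and mult_O\<^sub>K: "(\<otimes>\<^bsub>O\<^sub>K\<^esub>) = (*)" and one_O\<^sub>K: "\<one>\<^bsub>O\<^sub>K\<^esub> = 1"
proof -
  show m: "(\<otimes>\<^bsub>O\<^sub>K\<^esub>) = (*)" and o: "\<one>\<^bsub>O\<^sub>K\<^esub> = 1" by (simp_all add: O\<^sub>K_def K_def type_field_def)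
  show "comm_monoid O\<^sub>K"
    by (rule comm_monoidI) (auto simp: m o carrier_O\<^sub>K ZW_mult)
qed

lemma Units_O\<^sub>K: "x \<in> Units O\<^sub>K \<longleftrightarrow> x \<noteq> 0 \<and> x \<in> ZW \<and> inverse x \<in> ZW"
proof
  assume "x \<in> Units O\<^sub>K"
  then obtain y where "x \<in> ZW" "y \<in> ZW" "x * y = 1"
    unfolding Units_def carrier_O\<^sub>K mult_O\<^sub>K one_O\<^sub>K by blast
  then show "x \<noteq> 0 \<and> x \<in> ZW \<and> inverse x \<in> ZW" using inverse_unique[of x y] by auto
next
  assume "x \<noteq> 0 \<and> x \<in> ZW \<and> inverse x \<in> ZW"
  then show "x \<in> Units O\<^sub>K"
    unfolding Units_def carrier_O\<^sub>K mult_O\<^sub>K one_O\<^sub>K by (auto intro!: bexI[of _ "inverse x"])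
qed

lemma inv_units_of_O\<^sub>K: "x \<in> Units O\<^sub>K \<Longrightarrow> inv\<^bsub>units_of O\<^sub>K\<^esub> x = inverse x"
proof -
  interpret comm_monoid O\<^sub>K by (rule monoid_O\<^sub>K)
  assume x: "x \<in> Units O\<^sub>K"
  then have "inverse x \<in> Units O\<^sub>K" by (simp add: Units_O\<^sub>K)
  with x show ?thesis
    using group.inv_equality[OF units_group, of "inverse x" x]
    by (simp add: units_of_def mult_O\<^sub>K one_O\<^sub>K Units_O\<^sub>K)
qed

definition unit_power :: "nat \<Rightarrow> int \<Rightarrow> int \<Rightarrow> real" where
  "unit_power m a b = (u\<^sub>K ^ m) powi a * (v\<^sub>K ^ 2) powi b"

lemma u_unit: "u\<^sub>K \<noteq> 0" "u\<^sub>K \<in> ZW" "inverse u\<^sub>K \<in> ZW" and v_unit: "v\<^sub>K \<noteq> 0" "v\<^sub>K \<in> ZW" "inverse v\<^sub>K \<in> ZW"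
  using u\<^sub>K_unit v\<^sub>K_unit by (simp_all add: Units_O\<^sub>K)

lemma unit_power_add: "unit_power m a b * unit_power m a' b' = unit_power m (a + a') (b + b')"
  using u_unit(1) v_unit(1) by (simp add: unit_power_def power_int_add mult_ac)

lemma unit_power_0 [simp]: "unit_power m 0 0 = 1"
  by (simp add: unit_power_def)

lemma inverse_unit_power: "inverse (unit_power m a b) = unit_power m (- a) (- b)"
  by (simp add: unit_power_def power_int_minus)

text \<open>Carries multiplicative properties, such as integrality or a residue equal to 1, from the
  generators and their inverses to the whole group.\<close>

lemma unit_power_induct:
  assumes "\<And>x y. P x \<Longrightarrow> P y \<Longrightarrow> P (x * y)" "P 1"
    and "P (u\<^sub>K ^ m)" "P (inverse (u\<^sub>K ^ m))" "P (v\<^sub>K ^ 2)" "P (inverse (v\<^sub>K ^ 2))"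
  shows "P (unit_power m a b)"
proof -
  have nat: "P (x ^ n)" if "P x" for x n
    using that assms(1,2) by (induction n) auto
  have "P (x powi n)" if "P x" "P (inverse x)" for x n
    using nat that unfolding power_int_def by auto
  then show ?thesis unfolding unit_power_def using assms by blast
qed

lemma unit_power_in_ZW: "unit_power m a b \<in> ZW"
  by (rule unit_power_induct) (simp_all add: ZW_mult ZW_power u_unit v_unit flip: power_inverse)

lemma carrier_U: "carrier (U m 1) = {unit_power m a b |a b. True}"
proof -
  interpret M: comm_monoid O\<^sub>K by (rule monoid_O\<^sub>K)
  have gens: "u\<^sub>K ^ m \<in> Units O\<^sub>K" "v\<^sub>K ^ 2 \<in> Units O\<^sub>K"
    by (simp_all add: Units_O\<^sub>K ZW_power u_unit v_unit flip: power_inverse)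
  have car: "carrier (U m 1) = generate (units_of O\<^sub>K) {u\<^sub>K ^ m, v\<^sub>K ^ 2}"
    using gens by (simp add: U_def carrier_subgroup_generated units_of_carrier Int_absorb2)
  have one: "\<one>\<^bsub>units_of O\<^sub>K\<^esub> = 1" and mult: "x \<otimes>\<^bsub>units_of O\<^sub>K\<^esub> y = x * y" for x y
    by (simp_all add: units_of_def mult_O\<^sub>K one_O\<^sub>K)
  have gen: "u\<^sub>K ^ m = unit_power m 1 0" "v\<^sub>K ^ 2 = unit_power m 0 1" by (simp_all add: unit_power_def)
  have "\<exists>a b. x = unit_power m a b" if "x \<in> generate (units_of O\<^sub>K) {u\<^sub>K ^ m, v\<^sub>K ^ 2}" for x
    using that
  proof (induction rule: generate.induct)
    case one
    have "\<one>\<^bsub>units_of O\<^sub>K\<^esub> = unit_power m 0 0" by (simp add: \<open>\<one>\<^bsub>units_of O\<^sub>K\<^esub> = 1\<close>)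
    then show ?case by blast
  next
    case (incl h)
    then show ?case using gen by auto
  next
    case (inv h)
    then have "h \<in> Units O\<^sub>K" "\<exists>a b. h = unit_power m a b" using gens gen by auto
    then show ?case using inv_units_of_O\<^sub>K inverse_unit_power by metis
  next
    case (eng h1 h2)
    then show ?case unfolding mult using unit_power_add by metis
  qed
  moreover have "unit_power m a b \<in> generate (units_of O\<^sub>K) {u\<^sub>K ^ m, v\<^sub>K ^ 2}" for a b
  proof (rule unit_power_induct)
    fix x y assume "x \<in> generate (units_of O\<^sub>K) {u\<^sub>K ^ m, v\<^sub>K ^ 2}" "y \<in> generate (units_of O\<^sub>K) {u\<^sub>K ^ m, v\<^sub>K ^ 2}"
    then show "x * y \<in> generate (units_of O\<^sub>K) {u\<^sub>K ^ m, v\<^sub>K ^ 2}" using generate.eng[of x "units_of O\<^sub>K"] unfolding mult by blast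
  next
    show "1 \<in> generate (units_of O\<^sub>K) {u\<^sub>K ^ m, v\<^sub>K ^ 2}" using generate.one[of "units_of O\<^sub>K"] unfolding one .
    show "u\<^sub>K ^ m \<in> generate (units_of O\<^sub>K) {u\<^sub>K ^ m, v\<^sub>K ^ 2}" "v\<^sub>K ^ 2 \<in> generate (units_of O\<^sub>K) {u\<^sub>K ^ m, v\<^sub>K ^ 2}"
      by (simp_all add: generate.incl)
    show "inverse (u\<^sub>K ^ m) \<in> generate (units_of O\<^sub>K) {u\<^sub>K ^ m, v\<^sub>K ^ 2}" "inverse (v\<^sub>K ^ 2) \<in> generate (units_of O\<^sub>K) {u\<^sub>K ^ m, v\<^sub>K ^ 2}"
      using generate.inv[of _ "{u\<^sub>K ^ m, v\<^sub>K ^ 2}" "units_of O\<^sub>K"] inv_units_of_O\<^sub>K gens by (metis insertCI)+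
  qed
  ultimately show ?thesis unfolding car by blast
qed

lemma carrier_OT_group: "carrier (OT_group m 1) = ZW \<times> {unit_power m a b |a b. True}"
  and mult_OT_group: "(h, k) \<otimes>\<^bsub>OT_group m 1\<^esub> (h', k') = (h + k * h', k * k')"
  and one_OT_group: "\<one>\<^bsub>OT_group m 1\<^esub> = (0, 1)"
  unfolding OT_group_def carrier_U carrier_O\<^sub>K by simp_all

lemmas OT_group_simps = carrier_OT_group[unfolded One_nat_def] mult_OT_group[unfolded One_nat_def] one_OT_group[unfolded One_nat_def]

lemma group_OT_group: "group (OT_group m 1)"
proof (rule groupI)
  fix x assume "x \<in> carrier (OT_group m 1)"
  then obtain h a b where x: "x = (h, unit_power m a b)" "h \<in> ZW" by (auto simp: OT_group_simps)
  show "\<exists>y\<in>carrier (OT_group m 1). y \<otimes>\<^bsub>OT_group m 1\<^esub> x = \<one>\<^bsub>OT_group m 1\<^esub>"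
    by (rule bexI[of _ "(- (unit_power m (- a) (- b) * h), unit_power m (- a) (- b))"])
      (auto simp: x OT_group_simps unit_power_add intro!: ZW_minus ZW_mult unit_power_in_ZW)
next
  have "unit_power m a b * unit_power m a' b' \<in> {unit_power m a b |a b. True}" for a b a' b'
    unfolding unit_power_add by blast
  then show "x \<otimes>\<^bsub>OT_group m 1\<^esub> y \<in> carrier (OT_group m 1)" if "x \<in> carrier (OT_group m 1)" "y \<in> carrier (OT_group m 1)" for x y
    using that by (auto simp: OT_group_simps intro!: ZW_add ZW_mult unit_power_in_ZW)
  have "1 \<in> {unit_power m a b |a b. True}" by (metis (mono_tags, lifting) mem_Collect_eq unit_power_0)
  then show "\<one>\<^bsub>OT_group m 1\<^esub> \<in> carrier (OT_group m 1)" by (simp add: OT_group_simps)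
qed (auto simp: OT_group_simps algebra_simps)

section \<open>Residues modulo 2 and 7\<close>

lemma comm_group_DirProd:
  assumes "comm_group G" "comm_group H" shows "comm_group (G \<times>\<times> H)"
proof -
  interpret G: comm_group G by fact
  interpret H: comm_group H by fact
  show ?thesis
    by (rule group.group_comm_groupI[OF DirProd_group[OF G.is_group H.is_group]])
      (auto simp: G.m_comm H.m_comm)
qed

definition coords :: "real \<Rightarrow> int \<times> int \<times> int \<times> int" where
  "coords x = (THE (a, b, c, d). x = zw a b c d)"

lemma coords_zw [simp]: "coords (zw a b c d) = (a, b, c, d)"
  unfolding coords_def by (rule the_equality) (auto simp: zw_eq_iff)

text \<open>Together with \<open>residue1\<close> this describes the class in Z[w]/(w^2), where
  \<open>2 = w^4\<close> vanishes.\<close>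

definition residue0 :: "real \<Rightarrow> int" where "residue0 x = (case coords x of (a, b, c, d) \<Rightarrow> a mod 2)"
definition residue1 :: "real \<Rightarrow> int" where "residue1 x = (case coords x of (a, b, c, d) \<Rightarrow> b mod 2)"

text \<open>Reduction modulo the prime \<open>(1 + w\<^sup>3)\<close> of norm \<open>-7\<close>, which sends \<open>w\<close> to \<open>-2\<close>.\<close>

definition residue7 :: "real \<Rightarrow> int" where
  "residue7 x = (case coords x of (a, b, c, d) \<Rightarrow> (a - 2 * b + 4 * c - 8 * d) mod 7)"

lemma residue_zw [simp]: "residue0 (zw a b c d) = a mod 2" "residue1 (zw a b c d) = b mod 2"
  "residue7 (zw a b c d) = (a - 2 * b + 4 * c - 8 * d) mod 7"
  by (simp_all add: residue0_def residue1_def residue7_def)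

lemma residue_add:
  assumes "x \<in> ZW" "y \<in> ZW"
  shows "residue0 (x + y) = (residue0 x + residue0 y) mod 2" "residue1 (x + y) = (residue1 x + residue1 y) mod 2"
    "residue7 (x + y) = (residue7 x + residue7 y) mod 7"
proof -
  obtain a b c d where x: "x = zw a b c d" using assms(1) by (rule ZW_cases)
  obtain a' b' c' d' where y: "y = zw a' b' c' d'" using assms(2) by (rule ZW_cases)
  show "residue0 (x + y) = (residue0 x + residue0 y) mod 2" "residue1 (x + y) = (residue1 x + residue1 y) mod 2"
    by (simp_all add: x y zw_add mod_simps)
  show "residue7 (x + y) = (residue7 x + residue7 y) mod 7"
    by (simp add: x y zw_add mod_simps) (simp add: algebra_simps)
qed

lemma residue7_mult:
  assumes "x \<in> ZW" "y \<in> ZW" shows "residue7 (x * y) = (residue7 x * residue7 y) mod 7"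
proof -
  obtain a b c d where x: "x = zw a b c d" using assms(1) by (rule ZW_cases)
  obtain a' b' c' d' where y: "y = zw a' b' c' d'" using assms(2) by (rule ZW_cases)
  let ?r = "a * a' + 2 * (b * d' + c * c' + d * b') - 2 * (a * b' + b * a' + 2 * (c * d' + d * c'))
    + 4 * (a * c' + b * b' + c * a' + 2 * d * d') - 8 * (a * d' + b * c' + c * b' + d * a')"
  \<comment> \<open>The multiple of 7 stems from \<open>w^4 - 2\<close>, which takes the value 14 at
    -2.\<close>
  have "(a - 2 * b + 4 * c - 8 * d) * (a' - 2 * b' + 4 * c' - 8 * d')
      = ?r + 7 * (2 * (b * d' + c * c' + d * b') - 4 * (c * d' + d * c') + 8 * d * d')"
    by (simp add: algebra_simps)
  then have "?r mod 7 = ((a - 2 * b + 4 * c - 8 * d) * (a' - 2 * b' + 4 * c' - 8 * d')) mod 7"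
    by (metis mod_mult_self2)
  then show ?thesis by (simp only: x y zw_mult residue_zw mod_mult_eq)
qed

text \<open>An element congruent to 1 modulo w^2 acts trivially on Z[w]/(w^2).\<close>

lemma residue01_mult:
  assumes "x \<in> ZW" "y \<in> ZW" "residue0 x = 1" "residue1 x = 0"
  shows "residue0 (x * y) = residue0 y" "residue1 (x * y) = residue1 y"
proof -
  obtain a b c d where x: "x = zw a b c d" using assms(1) by (rule ZW_cases)
  obtain a' b' c' d' where y: "y = zw a' b' c' d'" using assms(2) by (rule ZW_cases)
  have "odd a" "even b" using assms(3,4) by (auto simp: x odd_iff_mod_2_eq_one even_iff_mod_2_eq_zero)
  then obtain i j where ij: "a = 2 * i + 1" "b = 2 * j" by (auto elim!: oddE evenE)
  have "a * a' + 2 * (b * d' + c * c' + d * b') = a' + 2 * (i * a' + (b * d' + c * c' + d * b'))"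
    "a * b' + b * a' + 2 * (c * d' + d * c') = b' + 2 * (i * b' + j * a' + (c * d' + d * c'))"
    by (simp_all add: ij algebra_simps)
  then show "residue0 (x * y) = residue0 y" "residue1 (x * y) = residue1 y"
    unfolding x y zw_mult residue_zw by (metis mod_mult_self2)+
qed

lemma u_eq_zw: "u\<^sub>K = zw (- 1) 0 1 0" and inverse_u_eq_zw: "inverse u\<^sub>K = zw 1 0 1 0"
  and v2_eq_zw: "v\<^sub>K ^ 2 = zw 1 2 1 0" and inverse_v2_eq_zw: "inverse (v\<^sub>K ^ 2) = zw 7 (- 6) 5 (- 4)"
proof -
  show u: "u\<^sub>K = zw (- 1) 0 1 0" by (simp add: u\<^sub>K_def zw_def)
  show v: "v\<^sub>K ^ 2 = zw 1 2 1 0" by (simp add: v\<^sub>K_def zw_def w_ring_simps)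
  have one: "zw 1 0 0 0 = 1" by (simp add: zw_def)
  show "inverse u\<^sub>K = zw 1 0 1 0" by (rule inverse_unique) (simp add: u zw_mult one)
  \<comment> \<open>The square of the inverse \<open>w^3 - w^2 + w - 1\<close> of
    \<open>w + 1\<close>.\<close>
  show "inverse (v\<^sub>K ^ 2) = zw 7 (- 6) 5 (- 4)" by (rule inverse_unique) (simp add: v zw_mult one)
qed

lemma zw_1: "zw 1 0 0 0 = 1" by (simp add: zw_def)

lemma residue_1: "residue0 1 = 1" "residue1 1 = 0" "residue7 1 = 1"
  by (simp_all flip: zw_1)

lemma residue01_power:
  assumes "x \<in> ZW" "residue0 x = 1" "residue1 x = 0"
  shows "residue0 (x ^ n) = 1 \<and> residue1 (x ^ n) = 0"
  by (induction n) (use assms in \<open>simp_all add: residue_1 residue01_mult ZW_power\<close>)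

lemma residue01_unit_power: "residue0 (unit_power m a b) = 1" "residue1 (unit_power m a b) = 0"
proof -
  let ?P = "\<lambda>x. x \<in> ZW \<and> residue0 x = 1 \<and> residue1 x = 0"
  have "?P (unit_power m a b)"
  proof (rule unit_power_induct)
    show "?P (x * y)" if "?P x" "?P y" for x y using that by (simp add: residue01_mult ZW_mult)
    show "?P 1" by (simp add: residue_1)
    show "?P (u\<^sub>K ^ m)" unfolding u_eq_zw by (simp add: ZW_power residue01_power)
    show "?P (inverse (u\<^sub>K ^ m))"
      unfolding power_inverse[symmetric] inverse_u_eq_zw by (simp add: ZW_power residue01_power)
    show "?P (v\<^sub>K ^ 2)" unfolding v2_eq_zw by simp
    show "?P (inverse (v\<^sub>K ^ 2))" unfolding inverse_v2_eq_zw by simp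
  qed
  then show "residue0 (unit_power m a b) = 1" "residue1 (unit_power m a b) = 0" by blast+
qed

lemma residue7_u_power: "residue7 (u\<^sub>K ^ m) = 3 ^ m mod 7"
proof (induction m)
  case (Suc m)
  have "residue7 u\<^sub>K = 3" by (simp add: u_eq_zw)
  then show ?case using residue7_mult[OF u_unit(2) ZW_power[OF u_unit(2)], of m] Suc by (simp add: mod_simps)
qed (simp add: residue_1)

text \<open>As \<open>3^6 = 729\<close> is 1 modulo 7, only the exponent modulo 6 counts, and six
  cases remain.\<close>

lemma power_3_mod_7: "(3::int) ^ m mod 7 = 1 \<longleftrightarrow> 6 dvd m"
proof -
  have "(3::int) ^ m = (3 ^ 6) ^ (m div 6) * 3 ^ (m mod 6)"
    unfolding power_mult[symmetric] power_add[symmetric] by (simp only: mult_div_mod_eq)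
  then have "(3::int) ^ m mod 7 = ((3 ^ 6) mod 7) ^ (m div 6) * 3 ^ (m mod 6) mod 7"
    by (metis mod_mult_left_eq power_mod)
  also have "\<dots> = 3 ^ (m mod 6) mod 7" by simp
  finally have *: "(3::int) ^ m mod 7 = 3 ^ (m mod 6) mod 7" .
  have "m mod 6 < 6" by simp
  then consider "m mod 6 = 0" | "m mod 6 = 1" | "m mod 6 = 2" | "m mod 6 = 3" | "m mod 6 = 4" | "m mod 6 = 5" by linarith
  then show ?thesis unfolding * dvd_eq_mod_eq_0 by cases simp_all
qed

text \<open>At \<open>w = -2\<close> the unit \<open>w + 1\<close> becomes -1, with square 1, and
  \<open>u^m\<close> becomes \<open>3^m\<close>, which is 1 modulo 7.\<close>

lemma residue7_unit_power:
  assumes "6 dvd m" shows "residue7 (unit_power m a b) = 1"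
proof -
  let ?P = "\<lambda>x. x \<in> ZW \<and> residue7 x = 1"
  have "?P (unit_power m a b)"
  proof (rule unit_power_induct)
    show "?P (x * y)" if "?P x" "?P y" for x y using that by (simp add: residue7_mult ZW_mult)
    show "?P 1" by (simp add: residue_1)
    show u: "?P (u\<^sub>K ^ m)" using assms by (simp add: ZW_power u_unit residue7_u_power power_3_mod_7)
    have "inverse (u\<^sub>K ^ m) \<in> ZW" by (simp add: ZW_power u_unit flip: power_inverse)
    then show "?P (inverse (u\<^sub>K ^ m))"
      using residue7_mult[of "inverse (u\<^sub>K ^ m)" "u\<^sub>K ^ m"] u u_unit(1) zw_1
      by (simp add: residue_1) (smt (verit) case_prod_unfold mod_mod_trivial residue7_def)
    show "?P (v\<^sub>K ^ 2)" unfolding v2_eq_zw by simp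
    show "?P (inverse (v\<^sub>K ^ 2))" unfolding inverse_v2_eq_zw by simp
  qed
  then show ?thesis by blast
qed

lemma residue7_eq_0_imp_multiple:
  assumes "x \<in> ZW" "residue7 x = 0" obtains y where "y \<in> ZW" "x = (1 + w\<^sub>K ^ 3) * y"
proof -
  obtain a b c d where x: "x = zw a b c d" using assms(1) by (rule ZW_cases)
  then obtain r where r: "a - 2 * b + 4 * c - 8 * d = 7 * r" using assms(2) by (auto simp: mod_eq_0_iff_dvd)
  then have a: "a = 7 * r + 2 * b - 4 * c + 8 * d" by simp
  have e: "1 + w\<^sub>K ^ 3 = zw 1 0 0 1" by (simp add: zw_def)
  \<comment> \<open>The cofactor solves the coordinate equations from the top down, starting from
    the constant coordinate \<open>- r\<close>; the last equation is the formula for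
    \<open>a\<close>.\<close>
  have "x = (1 + w\<^sub>K ^ 3) * zw (- r) (b - 2 * c + 4 * d + 4 * r) (c - 2 * d - 2 * r) (d + r)"
    unfolding x e zw_mult zw_eq_iff a by simp
  then show ?thesis using that zw_in_ZW by blast
qed

text \<open>Because \<open>2 = w^4\<close>, even coefficients of 1 and w can be moved past a factor
  w^2.\<close>

lemma residue01_eq_0_imp_multiple:
  assumes "x \<in> ZW" "residue0 x = 0" "residue1 x = 0" obtains y where "y \<in> ZW" "x = w\<^sub>K ^ 2 * y"
proof -
  obtain a b c d where x: "x = zw a b c d" using assms(1) by (rule ZW_cases)
  then obtain a' b' where "a = 2 * a'" "b = 2 * b'" using assms(2,3) by (metis residue_zw(1,2) mod_eq_0_iff_dvd dvdE)
  then have "x = w\<^sub>K ^ 2 * zw c d a' b'" by (simp add: x zw_def w_ring_simps)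
  then show ?thesis using that zw_in_ZW by blast
qed

section \<open>The ideals generated by the commutators\<close>

lemma v2_minus_1: "v\<^sub>K ^ 2 - 1 = w\<^sub>K ^ 2 * (1 + w\<^sub>K ^ 3)"
  by (simp add: v\<^sub>K_def w_ring_simps)

lemma residue7_w2_mult: "y \<in> ZW \<Longrightarrow> residue7 (w\<^sub>K ^ 2 * y) = 4 * residue7 y mod 7"
proof -
  assume y: "y \<in> ZW"
  have "w\<^sub>K ^ 2 = zw 0 0 1 0" by (simp add: zw_def)
  then show ?thesis using residue7_mult[OF _ y, of "w\<^sub>K ^ 2"] by simp
qed

text \<open>Divide by w^2 first. It maps to 4, which is invertible modulo 7, so the quotient still
  has residue 0 and is divisible by \<open>1 + w^3\<close>.\<close>

lemma ideal_eq_if_6_dvd: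
  assumes "x \<in> ZW" "residue0 x = 0" "residue1 x = 0" "residue7 x = 0"
  obtains y where "y \<in> ZW" "x = (v\<^sub>K ^ 2 - 1) * y"
proof -
  obtain g where g: "g \<in> ZW" "x = w\<^sub>K ^ 2 * g" using residue01_eq_0_imp_multiple assms(1-3) by blast
  have "4 * residue7 g mod 7 = 0" using residue7_w2_mult[OF g(1)] assms(4) g(2) by simp
  then have "7 dvd 4 * residue7 g" by (simp add: mod_eq_0_iff_dvd)
  then have "residue7 g mod 7 = 0" by presburger
  then have "residue7 g = 0" by (simp add: residue7_def split: prod.splits)
  then obtain y where "y \<in> ZW" "g = (1 + w\<^sub>K ^ 3) * y" using residue7_eq_0_imp_multiple g(1) by blast
  then show ?thesis using that g(2) v2_minus_1 by (simp add: mult.assoc)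
qed

text \<open>After division by w^2 the element \<open>u^m - 1\<close> leaves some \<open>t\<close>
  with nonzero residue modulo 7. Subtracting a suitable multiple of \<open>t\<close> brings the
  residue of \<open>g\<close> to 0, and the rest is divisible by \<open>1 + w^3\<close>.\<close>

lemma ideal_eq_if_not_6_dvd:
  assumes "\<not> 6 dvd m" and x: "x \<in> ZW" "residue0 x = 0" "residue1 x = 0"
  obtains y z where "y \<in> ZW" "z \<in> ZW" "x = (v\<^sub>K ^ 2 - 1) * y + (u\<^sub>K ^ m - 1) * z"
proof -
  obtain g where g: "g \<in> ZW" "x = w\<^sub>K ^ 2 * g" using residue01_eq_0_imp_multiple x by blast
  have p: "u\<^sub>K ^ m \<in> ZW" by (simp add: ZW_power u_unit)
  have p1: "u\<^sub>K ^ m - 1 = u\<^sub>K ^ m + zw (- 1) 0 0 0" by (simp add: zw_def)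
  have "residue0 (u\<^sub>K ^ m - 1) = 0" "residue1 (u\<^sub>K ^ m - 1) = 0"
    unfolding p1 using residue01_unit_power[of m 1 0] p by (simp_all add: residue_add unit_power_def)
  then obtain t where t: "t \<in> ZW" "u\<^sub>K ^ m - 1 = w\<^sub>K ^ 2 * t"
    using residue01_eq_0_imp_multiple[of "u\<^sub>K ^ m - 1"] p ZW_diff by (metis ZW_1)
  have "residue7 (u\<^sub>K ^ m - 1) = (3 ^ m mod 7 + 6) mod 7"
    unfolding p1 using p by (simp add: residue_add residue7_u_power)
  moreover have "\<not> (3::int) ^ m mod 7 = 1" using assms(1) power_3_mod_7 by simp
  moreover have "(s + 6) mod 7 \<noteq> 0" if "s \<noteq> 1" "0 \<le> s" "s < 7" for s :: int using that by presburger
  ultimately have "4 * residue7 t mod 7 \<noteq> 0"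
    using residue7_w2_mult[OF t(1)] t(2) by simp
  then have "residue7 t \<noteq> 0" by auto
  moreover have "0 \<le> residue7 t" "residue7 t < 7" by (simp_all add: residue7_def split: prod.splits)
  ultimately consider "residue7 t = 1" | "residue7 t = 2" | "residue7 t = 3" | "residue7 t = 4" | "residue7 t = 5" | "residue7 t = 6"
    by linarith
  then have "\<exists>n. n * residue7 t mod 7 = 1"
    \<comment> \<open>The inverses of 1 to 6 modulo 7, in order.\<close>
    by cases (auto intro: exI[of _ 1] exI[of _ 4] exI[of _ 5] exI[of _ 2] exI[of _ 3] exI[of _ 6])
  then obtain n where n: "n * residue7 t mod 7 = 1" ..
  then have "7 dvd n * residue7 t - 1" by (subst mod_eq_dvd_iff[symmetric]) simp
  then have dvd: "7 dvd residue7 g + (- n) * (residue7 g * residue7 t)"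
    using dvd_mult[of 7 "n * residue7 t - 1" "- residue7 g"] by (simp add: algebra_simps)
  have "of_int (- n) = zw (- n) 0 0 0" by (simp add: zw_def)
  then have "residue7 (of_int (- n)) = (- n) mod 7" by simp
  then have "residue7 (g + of_int (- n) * (g * t)) = (residue7 g + (- n) * (residue7 g * residue7 t)) mod 7"
    using g(1) t(1) by (simp only: residue_add residue7_mult ZW_mult ZW_of_int mod_simps)
  also have "\<dots> = 0" using dvd by (simp only: mod_eq_0_iff_dvd)
  finally have "residue7 (g - of_int n * g * t) = 0" by (simp add: mult.assoc)
  then obtain y where "y \<in> ZW" "g - of_int n * g * t = (1 + w\<^sub>K ^ 3) * y"
    using residue7_eq_0_imp_multiple by (metis ZW_diff ZW_mult ZW_of_int g(1) t(1))
  then have "g = (1 + w\<^sub>K ^ 3) * y + of_int n * g * t" by (simp only: diff_eq_eq)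
  then have "x = w\<^sub>K ^ 2 * ((1 + w\<^sub>K ^ 3) * y + of_int n * g * t)" using g(2) by metis
  also have "\<dots> = (v\<^sub>K ^ 2 - 1) * y + (u\<^sub>K ^ m - 1) * (of_int n * g)"
    unfolding v2_minus_1 t(2) by (simp only: distrib_left mult_ac)
  finally have "x = (v\<^sub>K ^ 2 - 1) * y + (u\<^sub>K ^ m - 1) * (of_int n * g)" .
  then show ?thesis using that \<open>y \<in> ZW\<close> g(1) ZW_mult ZW_of_int by blast
qed

section \<open>The action on the product of half planes and the complex plane\<close>

locale OT_embeddings =
  fixes \<sigma>\<^sub>1 \<sigma>\<^sub>2 :: "real \<Rightarrow> real" and \<sigma>\<^sub>3 :: "real \<Rightarrow> complex" and m :: nat
  assumes s1: "\<sigma>\<^sub>1 \<in> field_embeddings" "\<sigma>\<^sub>1 w\<^sub>K = w\<^sub>K"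
    and s2: "\<sigma>\<^sub>2 \<in> field_embeddings" "\<sigma>\<^sub>2 w\<^sub>K = - w\<^sub>K"
    and s3: "\<sigma>\<^sub>3 \<in> field_embeddings" "\<not> \<sigma>\<^sub>3 ` carrier K \<subseteq> \<real>"
    and m_pos: "m \<ge> 1"
begin

sublocale s1: embedding \<sigma>\<^sub>1 using s1(1) by unfold_locales
sublocale s2: embedding \<sigma>\<^sub>2 using s2(1) by unfold_locales
sublocale s3: embedding \<sigma>\<^sub>3 using s3(1) by unfold_locales

lemma s1_ZW: "x \<in> ZW \<Longrightarrow> \<sigma>\<^sub>1 x = x"
proof -
  assume "x \<in> ZW"
  then obtain a b c d where x: "x = zw a b c d" by (rule ZW_cases)
  show ?thesis unfolding x s1.hom_zw s1(2) by (simp add: zw_def)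
qed

section \<open>Discreteness of units and translations\<close>

lemma unit_power_pos: "0 < unit_power m a b"
proof -
  have "1 * 1 < w\<^sub>K * w\<^sub>K" using w_bounds(1) by (intro mult_strict_mono) auto
  then have "0 < u\<^sub>K" by (simp add: u\<^sub>K_def power2_eq_square)
  then show ?thesis using v_unit(1) by (simp add: unit_power_def)
qed

lemma v_power_unit: "v\<^sub>K ^ 2 \<in> ZW" "inverse (v\<^sub>K ^ 2) \<in> ZW" "u\<^sub>K ^ m \<in> ZW" "inverse (u\<^sub>K ^ m) \<in> ZW"
  by (simp_all add: ZW_power u_unit v_unit flip: power_inverse)

text \<open>Replacing w by -w fixes \<open>w^2 - 1\<close> and turns \<open>1 + w\<close> into
  \<open>1 - w\<close>.\<close>

lemma s2_unit_power: "\<sigma>\<^sub>2 (unit_power m a b) = (u\<^sub>K ^ m) powi a * ((1 - w\<^sub>K) ^ 2) powi b"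
proof -
  have "\<sigma>\<^sub>2 u\<^sub>K = u\<^sub>K" "\<sigma>\<^sub>2 (v\<^sub>K ^ 2) = (1 - w\<^sub>K) ^ 2"
    by (simp_all only: u_eq_zw v2_eq_zw s2.hom_zw s2(2)) (simp_all add: zw_def power2_eq_square algebra_simps)
  moreover have "(u\<^sub>K ^ m) powi a \<in> ZW" "(v\<^sub>K ^ 2) powi b \<in> ZW"
    using unit_power_in_ZW[of m a 0] unit_power_in_ZW[of m 0 b] by (simp_all add: unit_power_def)
  ultimately show ?thesis
    unfolding unit_power_def using v_power_unit u_unit v_unit
    by (simp add: s2.hom_mult s2.hom_power_int s2.hom_power)
qed

lemma s2_unit_power_pos: "0 < \<sigma>\<^sub>2 (unit_power m a b)"
proof -
  have "0 < (u\<^sub>K ^ m) powi a" using unit_power_pos[of a 0] by (simp add: unit_power_def)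
  moreover have "0 < ((1 - w\<^sub>K) ^ 2) powi b" using w_bounds(1) by simp
  ultimately show ?thesis by (simp add: s2_unit_power)
qed

text \<open>The factor u cancels in the quotient of the two real embeddings, which is a power of
  \<open>r = ((w + 1) / (w - 1))^2\<close>. As \<open>r\<close> is at least 4, the bounds force
  \<open>b = 0\<close>; then \<open>u^m < 1/2\<close> forces \<open>a = 0\<close>.\<close>

lemma unit_power_near_1:
  assumes "1 / 2 < unit_power m a b" "unit_power m a b < 2"
    and "1 / 2 < \<sigma>\<^sub>2 (unit_power m a b)" "\<sigma>\<^sub>2 (unit_power m a b) < 2"
  shows "a = 0 \<and> b = 0"
proof -
  define r where "r = ((w\<^sub>K + 1) / (w\<^sub>K - 1)) ^ 2"
  have "2 \<le> (w\<^sub>K + 1) / (w\<^sub>K - 1)" using w_bounds by (simp add: field_simps)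
  then have r: "4 \<le> r" unfolding r_def using power_mono[of 2 "(w\<^sub>K + 1) / (w\<^sub>K - 1)" 2] by simp
  have "r powi b = (v\<^sub>K ^ 2) powi b / ((1 - w\<^sub>K) ^ 2) powi b"
    by (simp add: r_def v\<^sub>K_def power_divide power_int_divide_distrib power2_commute)
  also have "\<dots> = unit_power m a b / \<sigma>\<^sub>2 (unit_power m a b)"
    unfolding s2_unit_power using u_unit(1) by (simp add: unit_power_def)
  finally have rb: "r powi b = unit_power m a b / \<sigma>\<^sub>2 (unit_power m a b)" .
  have "inverse 4 < r powi b" "r powi b < 4"
    unfolding rb using assms by (simp_all add: field_simps)
  then have b: "b = 0" using r power_int_near_1_imp_0[of 4 r b] by simp
  have u: "0 < u\<^sub>K" "u\<^sub>K < 1 / 2"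
    using w_bounds mult_strict_mono[of 1 "w\<^sub>K" 1 "w\<^sub>K"] by (simp_all add: u\<^sub>K_def power2_eq_square)
  have "u\<^sub>K ^ m \<le> u\<^sub>K ^ 1" using u m_pos by (intro power_decreasing) auto
  then have "u\<^sub>K ^ m < 1 / 2" "0 < u\<^sub>K ^ m" using u by auto
  then have "2 \<le> inverse (u\<^sub>K ^ m)" by (simp add: field_simps)
  moreover have "inverse (u\<^sub>K ^ m) powi (- a) = unit_power m a 0"
    by (simp add: unit_power_def power_int_minus power_int_inverse)
  ultimately have "- a = 0" using assms(1,2) b by (intro power_int_near_1_imp_0[of 2 "inverse (u\<^sub>K ^ m)"]) simp_all
  with b show ?thesis by simp
qed

text \<open>Independence of the generators: the quotient of two equal products is 1, which is near 1
  in both embeddings.\<close>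

lemma unit_power_eq_iff: "unit_power m a b = unit_power m a' b' \<longleftrightarrow> a = a' \<and> b = b'"
proof
  assume "unit_power m a b = unit_power m a' b'"
  then have "unit_power m (a - a') (b - b') = 1"
    using unit_power_add[of m a b "- a'" "- b'"] unit_power_add[of m a' b' "- a'" "- b'"] by simp
  then have "a - a' = 0 \<and> b - b' = 0" by (intro unit_power_near_1) (simp_all add: s2.hom_1)
  then show "a = a' \<and> b = b'" by simp
qed simp

text \<open>Half the sum and half the difference of the real embeddings are \<open>a + c w^2\<close>
  and \<open>b w + d w^3\<close>. The imaginary embedding bounds \<open>a - c w^2\<close> and
  \<open>b w - d w^3\<close>, so each single term is less than 1/2 in absolute value.\<close>

lemma discrete_embedding:
  assumes "h \<in> ZW" "\<bar>\<sigma>\<^sub>1 h\<bar> < 1 / 2" "\<bar>\<sigma>\<^sub>2 h\<bar> < 1 / 2" "norm (\<sigma>\<^sub>3 h) < 1 / 2"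
  shows "h = 0"
proof -
  obtain a b c d where h: "h = zw a b c d" using assms(1) by (rule ZW_cases)
  let ?w = "w\<^sub>K" and ?s = "\<sigma>\<^sub>3 w\<^sub>K"
  have w2: "1 < ?w ^ 2" using w_bounds(1) by (simp add: one_less_power)
  have small: "n = 0" if "\<bar>real_of_int n * x\<bar> < 1 / 2" "1 \<le> x" for n x
  proof (rule ccontr)
    assume "n \<noteq> 0"
    then have "1 \<le> \<bar>real_of_int n\<bar>" by linarith
    then have "1 * 1 \<le> \<bar>real_of_int n\<bar> * x" using that(2) by (intro mult_mono) auto
    then show False using that by (simp add: abs_mult)
  qed
  note im = imaginary_embedding_w[OF s3]
  have s: "?s = \<i> * of_real (Im ?s)" using im(1) by (simp add: complex_eq_iff)
  have s_sq: "?s ^ 2 = - of_real (?w ^ 2)"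
    by (subst s) (use im(2) in \<open>simp add: power_mult_distrib flip: of_real_power; metis power2_abs\<close>)
  have "\<sigma>\<^sub>3 h = of_real (of_int a - of_int c * ?w ^ 2) + of_real (of_int b - of_int d * ?w ^ 2) * ?s"
    unfolding h s3.hom_zw power3_eq_cube s_sq[unfolded power2_eq_square] s_sq
    by (simp add: algebra_simps power2_eq_square)
  then have re: "Re (\<sigma>\<^sub>3 h) = of_int a - of_int c * ?w ^ 2" and imh: "Im (\<sigma>\<^sub>3 h) = (of_int b - of_int d * ?w ^ 2) * Im ?s"
    using im(1) by simp_all
  have 1: "\<sigma>\<^sub>1 h = of_int a + of_int b * ?w + of_int c * ?w ^ 2 + of_int d * ?w ^ 3"
    and 2: "\<sigma>\<^sub>2 h = of_int a - of_int b * ?w + of_int c * ?w ^ 2 - of_int d * ?w ^ 3"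
    unfolding h s1.hom_zw s2.hom_zw s1(2) s2(2) by simp_all
  have 3: "\<bar>of_int a - of_int c * ?w ^ 2\<bar> < 1 / 2"
    using abs_Re_le_cmod[of "\<sigma>\<^sub>3 h"] assms(4) re by simp
  have "\<bar>Im (\<sigma>\<^sub>3 h)\<bar> < 1 / 2" using abs_Im_le_cmod[of "\<sigma>\<^sub>3 h"] assms(4) by simp
  then have "\<bar>(of_int b - of_int d * ?w ^ 2) * ?w\<bar> < 1 / 2" unfolding imh abs_mult im(2) using w_bounds(1) by simp
  then have 4: "\<bar>of_int b * ?w - of_int d * ?w ^ 3\<bar> < 1 / 2" by (simp add: algebra_simps power2_eq_square power3_eq_cube)
  have "a = 0" by (rule small[of a 1]) (use 1 2 3 assms(2,3) in linarith)+
  moreover have "c = 0" by (rule small[of c "?w ^ 2"]) (use 1 2 3 assms(2,3) w2 in linarith)+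
  moreover have "b = 0" by (rule small[of b ?w]) (use 1 2 4 assms(2,3) w_bounds(1) in linarith)+
  moreover have "d = 0"
  proof (rule small[of d "?w ^ 3"])
    show "1 \<le> ?w ^ 3" using w_bounds(1) by (intro one_le_power) simp
  qed (use 1 2 4 assms(2,3) in linarith)
  ultimately show ?thesis by (simp add: h zw_def)
qed

abbreviation "act \<equiv> OT_action \<sigma>\<^sub>1 \<sigma>\<^sub>2 \<sigma>\<^sub>3"

lemma wandering_set:
  assumes "z \<in> HHC"
  shows "\<exists>W. openin (top_of_set HHC) W \<and> z \<in> W \<and>
    (\<forall>g\<in>carrier (OT_group m 1). \<forall>y\<in>W. act g y \<in> W \<longrightarrow> g = \<one>\<^bsub>OT_group m 1\<^esub>)"
proof -
  obtain z1 z2 z3 where z: "z = (z1, z2, z3)" "0 < Im z1" "0 < Im z2" using assms by (auto simp: HHC_def)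
  \<comment> \<open>The bounds 2/3 and 4/3 keep ratios of imaginary parts between 1/2 and 2, as
    \<open>unit_power_near_1\<close> needs. Two radii of 1/4 add up to the 1/2 of
    \<open>discrete_embedding\<close>, which then excludes translations.\<close>
  define N where "N = {y :: complex \<times> complex \<times> complex.
    2 / 3 * Im z1 < Im (fst y) \<and> Im (fst y) < 4 / 3 * Im z1 \<and>
    2 / 3 * Im z2 < Im (fst (snd y)) \<and> Im (fst (snd y)) < 4 / 3 * Im z2 \<and>
    norm (fst y - z1) < 1 / 4 \<and> norm (fst (snd y) - z2) < 1 / 4 \<and> norm (snd (snd y) - z3) < 1 / 4}"
  have "open N"
    unfolding N_def by (intro open_Collect_conj open_Collect_less continuous_intros)
  then have "openin (top_of_set HHC) (HHC \<inter> N)" by (rule openin_open_Int)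
  moreover have "z \<in> HHC \<inter> N" using assms z by (simp add: N_def)
  moreover have "g = \<one>\<^bsub>OT_group m 1\<^esub>"
    if g: "g \<in> carrier (OT_group m 1)" and y: "y \<in> HHC \<inter> N" "act g y \<in> HHC \<inter> N" for g y
  proof -
    obtain h a b where g: "g = (h, unit_power m a b)" "h \<in> ZW" using g by (auto simp: OT_group_simps)
    obtain y1 y2 y3 where y': "y = (y1, y2, y3)" by (cases y)
    let ?k = "unit_power m a b"
    have k1: "\<sigma>\<^sub>1 ?k = ?k" using s1_ZW unit_power_in_ZW by blast
    have N1: "2 / 3 * Im z1 < Im y1" "Im y1 < 4 / 3 * Im z1" "2 / 3 * Im z1 < ?k * Im y1" "?k * Im y1 < 4 / 3 * Im z1"
      and N2: "2 / 3 * Im z2 < Im y2" "Im y2 < 4 / 3 * Im z2" "2 / 3 * Im z2 < \<sigma>\<^sub>2 ?k * Im y2" "\<sigma>\<^sub>2 ?k * Im y2 < 4 / 3 * Im z2"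
      using y by (simp_all add: N_def g y' OT_action_def k1)
    have ratio: "1 / 2 < k \<and> k < 2" if "0 < t" "2 / 3 * t < s" "s < 4 / 3 * t" "2 / 3 * t < k * s" "k * s < 4 / 3 * t" for k s t :: real
    proof -
      have "0 < s" using that by linarith
      have "1 / 2 * s < k * s" "k * s < 2 * s" using that by linarith+
      then show ?thesis using \<open>0 < s\<close> by (simp add: mult_less_cancel_right_pos)
    qed
    have "a = 0 \<and> b = 0"
      using ratio[OF z(2) N1] ratio[OF z(3) N2] unit_power_near_1 by blast
    then have k: "?k = 1" by simp
    have near: "norm (e + x - t) < 1 / 4 \<Longrightarrow> norm (x - t) < 1 / 4 \<Longrightarrow> norm e < 1 / 2" for e x t :: complex
      using norm_triangle_ineq4[of "e + x - t" "x - t"] by simp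
    have "norm (of_real (\<sigma>\<^sub>1 h) :: complex) < 1 / 2"
      using y by (intro near[of _ y1 z1]) (simp_all add: N_def g y' OT_action_def k s1.hom_1)
    moreover have "norm (of_real (\<sigma>\<^sub>2 h) :: complex) < 1 / 2"
      using y by (intro near[of _ y2 z2]) (simp_all add: N_def g y' OT_action_def k s2.hom_1)
    moreover have "norm (\<sigma>\<^sub>3 h) < 1 / 2"
      using y by (intro near[of _ y3 z3]) (simp_all add: N_def g y' OT_action_def k s3.hom_1)
    ultimately have "h = 0" using discrete_embedding[OF g(2)] by simp
    with g k show ?thesis by (simp add: OT_group_simps)
  qed
  ultimately show ?thesis by blast
qed

sublocale G: free_affine_action "OT_group m 1" act HHC
proof (intro free_affine_action.intro free_affine_action_axioms.intro group_OT_group)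
  show "convex HHC"
  proof (rule convexI)
    fix x y :: "complex \<times> complex \<times> complex" and s t :: real
    assume "x \<in> HHC" "y \<in> HHC" "0 \<le> s" "0 \<le> t" "s + t = 1"
    moreover from this have "0 < s * p + t * q" if "0 < p" "0 < q" for p q
      using convex_bound_lt[of "- p" 0 "- q" s t] that by simp
    ultimately show "s *\<^sub>R x + t *\<^sub>R y \<in> HHC"
      by (simp add: HHC_def case_prod_beta mem_Times_iff)
  qed
  have "(\<i>, \<i>, 0) \<in> HHC" by (simp add: HHC_def)
  then show "HHC \<noteq> {}" by blast
next
  fix g x assume "g \<in> carrier (OT_group m 1)" "x \<in> HHC"
  then show "act g x \<in> HHC"
    using unit_power_pos s2_unit_power_pos
    by (auto simp: OT_group_simps HHC_def OT_action_def s1_ZW unit_power_in_ZW)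
next
  show "act \<one>\<^bsub>OT_group m 1\<^esub> x = x" for x
    by (auto simp: OT_group_simps OT_action_def s1.hom_0 s2.hom_0 s3.hom_0 s1.hom_1 s2.hom_1 s3.hom_1 split: prod.splits)
next
  fix g h x assume "g \<in> carrier (OT_group m 1)" "h \<in> carrier (OT_group m 1)"
  then show "act (g \<otimes>\<^bsub>OT_group m 1\<^esub> h) x = act g (act h x)"
    by (auto simp: OT_group_simps OT_action_def s1.hom_add s2.hom_add s3.hom_add
        s1.hom_mult s2.hom_mult s3.hom_mult ZW_mult unit_power_in_ZW algebra_simps split: prod.splits)
next
  show "continuous_on HHC (act g)" for g
    unfolding OT_action_def case_prod_beta by (intro continuous_intros)
next
  fix g x y and s t :: real assume "s + t = 1"
  have comp: "e + k * (s *\<^sub>R x + t *\<^sub>R y) = s *\<^sub>R (e + k * x) + t *\<^sub>R (e + k * y)" for e k x y :: complex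
  proof -
    have "e = of_real (s + t) * e" using \<open>s + t = 1\<close> by simp
    then show ?thesis by (simp add: scaleR_conv_of_real algebra_simps)
  qed
  show "act g (s *\<^sub>R x + t *\<^sub>R y) = s *\<^sub>R act g x + t *\<^sub>R act g y"
    by (simp add: OT_action_def case_prod_beta comp)
qed (rule wandering_set)

section \<open>The abelianization of the group\<close>

definition exponents :: "real \<Rightarrow> int \<times> int" where
  "exponents k = (THE (a, b). k = unit_power m a b)"

lemma exponents_unit_power [simp]: "exponents (unit_power m a b) = (a, b)"
  unfolding exponents_def by (rule the_equality) (auto simp: unit_power_eq_iff)

text \<open>It is the commutator of \<open>(0, unit_power m a b)\<close> and
  \<open>(h, 1)\<close>.\<close>

lemma translation_in_derived:
  assumes "h \<in> ZW"
  shows "((unit_power m a b - 1) * h, 1) \<in> derived (OT_group m 1) (carrier (OT_group m 1))"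
proof -
  let ?k = "unit_power m a b" and ?G = "OT_group m 1"
  have one: "1 = unit_power m 0 0" by simp
  have car: "(0, ?k) \<in> carrier ?G" "(h, 1) \<in> carrier ?G" "(0, unit_power m (- a) (- b)) \<in> carrier ?G" "(- h, 1) \<in> carrier ?G"
    using assms one unfolding OT_group_simps[folded One_nat_def] by (blast intro: ZW_0 ZW_minus)+
  have inv_k: "inv\<^bsub>?G\<^esub> (0, ?k) = (0, unit_power m (- a) (- b))"
    using car by (intro group.inv_equality[OF group_OT_group]) (simp_all add: OT_group_simps unit_power_add)
  have inv_h: "inv\<^bsub>?G\<^esub> (h, 1) = (- h, 1)"
    using car by (intro group.inv_equality[OF group_OT_group]) (simp_all add: OT_group_simps)
  have eq: "(0, ?k) \<otimes>\<^bsub>?G\<^esub> (h, 1) \<otimes>\<^bsub>?G\<^esub> inv\<^bsub>?G\<^esub> (0, ?k) \<otimes>\<^bsub>?G\<^esub> inv\<^bsub>?G\<^esub> (h, 1) = ((?k - 1) * h, 1)"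
    unfolding inv_k inv_h by (simp add: OT_group_simps unit_power_add algebra_simps)
  have "((?k - 1) * h, 1) \<in> derived_set ?G (carrier ?G)"
    by (rule UN_I[OF car(1)], rule UN_I[OF car(2)]) (simp only: eq singleton_iff)
  then show ?thesis unfolding derived_def by (rule generate.incl)
qed

lemma derived_add:
  assumes "(x, 1) \<in> derived (OT_group m 1) (carrier (OT_group m 1))"
    and "(y, 1) \<in> derived (OT_group m 1) (carrier (OT_group m 1))"
  shows "(x + y, 1) \<in> derived (OT_group m 1) (carrier (OT_group m 1))"
  using subgroup.m_closed[OF group.derived_is_subgroup[OF group_OT_group subset_refl] assms]
  by (simp add: OT_group_simps)

lemma unit_power_gens: "u\<^sub>K ^ m = unit_power m 1 0" "v\<^sub>K ^ 2 = unit_power m 0 1"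
  by (simp_all add: unit_power_def)

text \<open>The acting units have residue 1, so the twist of the semidirect product disappears in
  the residues.\<close>

lemma residue_affine:
  assumes "x \<in> ZW" "y \<in> ZW"
  shows "residue0 (x + unit_power m a b * y) = (residue0 x + residue0 y) mod 2"
    "residue1 (x + unit_power m a b * y) = (residue1 x + residue1 y) mod 2"
    "6 dvd m \<Longrightarrow> residue7 (x + unit_power m a b * y) = (residue7 x + residue7 y) mod 7"
  using assms by (simp_all add: residue_add residue01_mult residue7_mult residue01_unit_power residue7_unit_power
      unit_power_in_ZW ZW_mult mod_simps)

lemma residue_bounds: "residue0 x \<in> {0..<2}" "residue1 x \<in> {0..<2}" "residue7 x \<in> {0..<7}"
  by (simp_all add: residue0_def residue1_def residue7_def split: prod.splits)

text \<open>The map \<open>\<eta>\<close> records the translation modulo w^2 and the exponents of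
  the unit. Its kernel consists of translations by multiples of w^2, and these lie in the ideal of
  \<open>v^2 - 1\<close> and \<open>u^m - 1\<close>, hence are products of commutators.\<close>

lemma first_homology_not_6_dvd:
  assumes "\<not> 6 dvd m"
  shows "homology_group 1 (OT_space \<sigma>\<^sub>1 \<sigma>\<^sub>2 \<sigma>\<^sub>3 m 1) \<cong>
    (integer_mod_group 2 \<times>\<times> integer_mod_group 2) \<times>\<times> (integer_group \<times>\<times> integer_group)"
  unfolding OT_space_def
proof (rule G.homology_quotient_iso)
  let ?A = "(integer_mod_group 2 \<times>\<times> integer_mod_group 2) \<times>\<times> (integer_group \<times>\<times> integer_group)"
  define \<eta> where "\<eta> = (\<lambda>(h, k). ((residue0 h, residue1 h), exponents k))"
  show "comm_group ?A" by (intro comm_group_DirProd) (simp_all add: abelian_integer_group)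
  show "\<eta> \<in> hom (OT_group m 1) ?A"
    by (rule homI) (use residue_bounds in \<open>auto simp: \<eta>_def OT_group_simps carrier_integer_mod_group
        residue_affine unit_power_add\<close>)
  show "\<eta> ` carrier (OT_group m 1) = carrier ?A"
  proof (intro equalityI subsetI)
    fix p assume "p \<in> carrier ?A"
    then obtain a b i j where p: "p = ((a, b), (i, j))" "a \<in> {0..<2}" "b \<in> {0..<2}"
      by (auto simp: carrier_integer_mod_group)
    then have "p = \<eta> (zw a b 0 0, unit_power m i j)" by (simp add: \<eta>_def)
    moreover have "(zw a b 0 0, unit_power m i j) \<in> carrier (OT_group m 1)" by (auto simp: OT_group_simps)
    ultimately show "p \<in> \<eta> ` carrier (OT_group m 1)" by (rule image_eqI)
  qed (use residue_bounds in \<open>auto simp: \<eta>_def OT_group_simps carrier_integer_mod_group\<close>)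
  show "kernel (OT_group m 1) ?A \<eta> \<subseteq> derived (OT_group m 1) (carrier (OT_group m 1))"
  proof
    fix g assume "g \<in> kernel (OT_group m 1) ?A \<eta>"
    then obtain h where g: "g = (h, 1)" "h \<in> ZW" "residue0 h = 0" "residue1 h = 0"
      by (auto simp: kernel_def OT_group_simps \<eta>_def)
    obtain y z where "y \<in> ZW" "z \<in> ZW" "h = (v\<^sub>K ^ 2 - 1) * y + (u\<^sub>K ^ m - 1) * z"
      using ideal_eq_if_not_6_dvd[OF assms g(2-4)] by blast
    then show "g \<in> derived (OT_group m 1) (carrier (OT_group m 1))"
      unfolding g(1) unit_power_gens using derived_add translation_in_derived by simp
  qed
qed

text \<open>Now the residue modulo 7 is also compatible with the product; the translations left in
  the kernel are multiples of \<open>v^2 - 1\<close>.\<close>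

lemma first_homology_6_dvd:
  assumes "6 dvd m"
  shows "homology_group 1 (OT_space \<sigma>\<^sub>1 \<sigma>\<^sub>2 \<sigma>\<^sub>3 m 1) \<cong>
    (integer_mod_group 2 \<times>\<times> integer_mod_group 2) \<times>\<times> integer_mod_group 7 \<times>\<times> (integer_group \<times>\<times> integer_group)"
  unfolding OT_space_def
proof (rule G.homology_quotient_iso)
  let ?A = "(integer_mod_group 2 \<times>\<times> integer_mod_group 2) \<times>\<times> integer_mod_group 7 \<times>\<times> (integer_group \<times>\<times> integer_group)"
  define \<eta> where "\<eta> = (\<lambda>(h, k). ((residue0 h, residue1 h), residue7 h, exponents k))"
  show "comm_group ?A" by (intro comm_group_DirProd) (simp_all add: abelian_integer_group)
  show "\<eta> \<in> hom (OT_group m 1) ?A"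
    by (rule homI) (use residue_bounds assms in \<open>auto simp: \<eta>_def OT_group_simps carrier_integer_mod_group
        residue_affine unit_power_add\<close>)
  show "\<eta> ` carrier (OT_group m 1) = carrier ?A"
  proof (intro equalityI subsetI)
    fix p assume "p \<in> carrier ?A"
    then obtain a b r i j where p: "p = ((a, b), r, (i, j))" "a \<in> {0..<2}" "b \<in> {0..<2}" "r \<in> {0..<7}"
      by (auto simp: carrier_integer_mod_group)
    \<comment> \<open>Since \<open>4 * 2\<close> is 1 modulo 7, the coefficient of w^2 can adjust
      the residue modulo 7 without changing those modulo 2.\<close>
    have "a - 2 * b + 4 * (2 * (r - a + 2 * b)) = r + 7 * (r - a + 2 * b)" by simp
    then have "(a - 2 * b + 4 * (2 * (r - a + 2 * b))) mod 7 = r" using p(4) by (simp only: mod_mult_self2) simp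
    then have "p = \<eta> (zw a b (2 * (r - a + 2 * b)) 0, unit_power m i j)" using p by (simp add: \<eta>_def)
    moreover have "(zw a b (2 * (r - a + 2 * b)) 0, unit_power m i j) \<in> carrier (OT_group m 1)" by (auto simp: OT_group_simps)
    ultimately show "p \<in> \<eta> ` carrier (OT_group m 1)" by (rule image_eqI)
  qed (use residue_bounds in \<open>auto simp: \<eta>_def OT_group_simps carrier_integer_mod_group\<close>)
  show "kernel (OT_group m 1) ?A \<eta> \<subseteq> derived (OT_group m 1) (carrier (OT_group m 1))"
  proof
    fix g assume "g \<in> kernel (OT_group m 1) ?A \<eta>"
    then obtain h where g: "g = (h, 1)" "h \<in> ZW" "residue0 h = 0" "residue1 h = 0" "residue7 h = 0"
      by (auto simp: kernel_def OT_group_simps \<eta>_def)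
    obtain y where "y \<in> ZW" "h = (v\<^sub>K ^ 2 - 1) * y"
      using ideal_eq_if_6_dvd[OF g(2-5)] by blast
    then show "g \<in> derived (OT_group m 1) (carrier (OT_group m 1))"
      unfolding g(1) unit_power_gens using translation_in_derived by simp
  qed
qed

end

section \<open>First homology of the Oeljeklaus-Toma threefold\<close>

theorem proposition3:
  fixes \<sigma>\<^sub>1 \<sigma>\<^sub>2 :: "real \<Rightarrow> real" and \<sigma>\<^sub>3 :: "real \<Rightarrow> complex" and m :: nat
  assumes "\<sigma>\<^sub>1 \<in> field_embeddings" and "\<sigma>\<^sub>1 w\<^sub>K = root 4 2"
    and "\<sigma>\<^sub>2 \<in> field_embeddings" and "\<sigma>\<^sub>2 w\<^sub>K = - root 4 2"
    and "\<sigma>\<^sub>3 \<in> field_embeddings" and "\<not> \<sigma>\<^sub>3 ` carrier K \<subseteq> \<real>"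
    and "m \<ge> 1"
  shows "(\<not> 6 dvd m \<longrightarrow> homology_group 1 (OT_space \<sigma>\<^sub>1 \<sigma>\<^sub>2 \<sigma>\<^sub>3 m 1) \<cong>
           (integer_mod_group 2 \<times>\<times> integer_mod_group 2) \<times>\<times> (integer_group \<times>\<times> integer_group))
       \<and> (6 dvd m \<longrightarrow> homology_group 1 (OT_space \<sigma>\<^sub>1 \<sigma>\<^sub>2 \<sigma>\<^sub>3 m 1) \<cong>
           (integer_mod_group 2 \<times>\<times> integer_mod_group 2) \<times>\<times> integer_mod_group 7
             \<times>\<times> (integer_group \<times>\<times> integer_group))"
proof -
  interpret OT_embeddings \<sigma>\<^sub>1 \<sigma>\<^sub>2 \<sigma>\<^sub>3 m
    using assms by unfold_locales (simp_all add: w\<^sub>K_def)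
  show ?thesis using first_homology_not_6_dvd first_homology_6_dvd by blast
qed

end
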